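(* Let $n\ge 0$ and let $\mathbf{w}=w_0w_1\cdots w_n$ be a generalized snake word of length $n$ (taken, without loss of generality, to end with the letter $R$ if $n\ge1$). Regard $J=J(P(\mathbf{w}))$ as a subset of $\mathbb{Z}^2$ via the embedding given in the context. Let $\mathcal{C}(z)$ be the chain polynomial of $J$, and let $A_{n+1,n+2}(z)$ be the coefficient polynomial in the expansion $\mathcal{C}(z)=A_{n+1,n+2}(z)\,\mathcal{C}_{n+1,n+2}(z)$, where $\mathcal{C}_{n+1,n+2}(z)$ is the chain polynomial of the subposet $J_{n+1,n+2}$. Then $$A_{n+1,n+2}(z)=W\{(-1,0),(n+1,n+2)\}.$$ Thus the chain polynomial of any generalized snake is given by $$\mathcal{C}(z)=W\{(-1,0),(n+1,n+2)\}\cdot(1+z).$$ Here $W\{(i,j),(p,q)\}$ is the sum of the weights of all possible valid paths from $(i,j)$ to $(p,q)$.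
   Context: Generalized snake words: for $n\ge 0$, a generalized snake word of length $n$ is $\mathbf{w}=w_0w_1\cdots w_n$ where $w_0=\varepsilon$ is the empty letter and $w_i\in\{L,R\}$ for $1\le i\le n$. Generalized snake posets: $P(\mathbf{w})$ is defined recursively. $P(\varepsilon)$ is the poset on $\{0,1,2,3\}$ with cover relations $1\prec 0$, $2\prec 0$, $3\prec 1$, $3\prec 2$. For $n\ge 1$, $P(w_0w_1\cdots w_n)$ is $P(w_0\cdots w_{n-1})\cup\{2n+2,2n+3\}$ with the added cover relations $2n+3\prec 2n+1$, $2n+3\prec 2n+2$, and: $2n+2\prec 2n-1$ if ($n=1$ and $w_1=L$) or ($n\ge2$ and $w_{n-1}w_n\in\{RL,LR\}$); $2n+2\prec 2n$ if ($n=1$ and $w_1=R$) or ($n\ge 2$ and $w_{n-1}w_n\in\{LL,RR\}$). $J(P)$ denotes the poset of upper order ideals (filters) of $P$, ordered by reverse inclusion; $\langle p_1,\dots,p_r\rangle$ denotes the filter generated by $p_1,\dots,p_r$. Embedding of $J(P(\mathbf{w}))$ into $\mathbb{Z}^2$ (recursive). Base step: for $w_0=\varepsilon$ send $\emptyset\mapsto(1,2)$, $\langle0\rangle\mapsto(1,1)$, $\langle1\rangle\mapsto(0,1)$, $\langle2\rangle\mapsto(1,0)$, $\langle1,2\rangle\mapsto(0,0)$, and $\langle3\rangle\mapsto(-1,0)$ if $w_1=R$ or $n=0$, $\langle3\rangle\mapsto(0,-1)$ if $w_1=L$. Recursive step, for $m=1,\dots,n$: let $k\ge0$ be the largest index $<m$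 with $w_k\ne w_m$. Shift the embedding of $J(P(w_0\cdots w_{m-1}))$ by $(1,1)$ and then place the new filters. If $w_m=R$: $\langle2m+2\rangle\mapsto(m-k+1,0)$, $\langle2m+2,2k+2\rangle\mapsto(m-k,0)$, and $\langle2m+2,2k+2i+1\rangle\mapsto(m-k-i,0)$ for $1\le i\le m-k$. If $w_m=L$: the same with the two coordinates exchanged. (When $k=0$ and $w_m=R$, read $\langle2m+2,1\rangle$ for $\langle2m+2,2k+2\rangle$.) Finally, $\langle2m+3\rangle\mapsto(-1,0)$ if $m=n$ or $w_{m+1}=R$, and $\langle2m+3\rangle\mapsto(0,-1)$ if $m<n$ and $w_{m+1}=L$. In the result the minimum of $J(P(\mathbf{w}))$ is at $(-1,0)$, the maximum $\emptyset$ is at $(n+1,n+2)$, and elements get larger going right or up. Identify $J=J(P(\mathbf{w}))$ with its image. Subposets: $J_{i,j}=\{(x,y)\in J: x\ge i,\ y\ge j\}$, and $\mathcal{C}_{i,j}(z)$ is its chain polynomial, so $\mathcal{C}(z)=\mathcal{C}_{-1,0}(z)$. Chain polynomial: the coefficient of $z^k$ is the number of chains with exactly $k$ elements (the empty chain contributing $1$). In particular $\mathcal{C}_{n+1,n+2}(z)=1+z$. Steps: $e_{i,j}$ denotes a step from $(i,j)$ to $(i+1,j)$, where $(i,j+1)\notin J$; $h_{i,j}^k$ (with $k\ge0$) denotes a step from $(i,j)$ to $(i+k,j+1)$ when $(i+k,j+1)\in J$. A valid path is a sequence of steps on $J$ consisting of steps $e_{i,j}$ and $h_{i,j}^k$.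 Weights: $e_{i,j}$ has weight $1+z$; $h_{i,j}^0$ has weight $1+z$; $h_{i,j}^k$ with $k>0$ has weight $z(1+z)^k$. The weight of a valid path is the product of the weights of all its steps.
   Formalization: A step h^k from (i,j) to (i+k,j+1) is allowed only if (i,j+1) and (i+k,j) also lie in J; requiring only (i+k,j+1) in J makes the claim false, already for n=0, where W would be (1+z)^2(1+6z+6z^2) instead of (1+z)^3(1+2z). *)

theory Defs
  imports "HOL-Computational_Algebra.Polynomial"
begin

section \<open>Generalized snake words and posets\<close>

datatype letter = Eps | L | R

definition snake_word :: "nat \<Rightarrow> letter list \<Rightarrow> bool" where
  "snake_word n w \<longleftrightarrow>
     length w = n + 1 \<and> w ! 0 = Eps \<and> (\<forall>i\<in>{1..n}. w ! i \<in> {L, R})"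

fun swap_letter :: "letter \<Rightarrow> letter" where
  "swap_letter Eps = Eps"
| "swap_letter L = R"
| "swap_letter R = L"

text \<open>Exchanging \<open>L\<close> and \<open>R\<close>. Every word of positive length either ends with \<open>R\<close> or is the
  mirror word of one that does.\<close>

definition mirror_word :: "letter list \<Rightarrow> letter list" where
  "mirror_word w = map swap_letter w"

text \<open>\<open>snake_covers w m\<close> contains \<open>(a, b)\<close> iff \<open>b\<close> covers \<open>a\<close> in the poset of the prefix
  \<open>w\<^sub>0 \<dots> w\<^sub>m\<close>.\<close>

fun snake_covers :: "letter list \<Rightarrow> nat \<Rightarrow> (nat \<times> nat) set" where
  "snake_covers w 0 = {(1, 0), (2, 0), (3, 1), (3, 2)}"
| "snake_covers w (Suc m) = (let n = Suc m in
     snake_covers w m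
     \<union> {(2*n+3, 2*n+1), (2*n+3, 2*n+2)}
     \<union> (if n = 1 \<and> w ! 1 = L \<or> n \<ge> 2 \<and> (w ! (n-1), w ! n) \<in> {(R, L), (L, R)}
         then {(2*n+2, 2*n-1)} else {})
     \<union> (if n = 1 \<and> w ! 1 = R \<or> n \<ge> 2 \<and> (w ! (n-1), w ! n) \<in> {(L, L), (R, R)}
         then {(2*n+2, 2*n)} else {}))"

definition snake_elems :: "nat \<Rightarrow> nat set" where
  "snake_elems n = {0..2*n+3}"

definition snake_le :: "letter list \<Rightarrow> nat \<Rightarrow> (nat \<times> nat) set" where
  "snake_le w n = (snake_covers w n)\<^sup>*"

section \<open>Filters\<close>

definition snake_filters :: "letter list \<Rightarrow> nat \<Rightarrow> nat set set" where
  "snake_filters w n =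
     {U. U \<subseteq> snake_elems n \<and> (\<forall>x\<in>U. \<forall>y. (x, y) \<in> snake_le w n \<longrightarrow> y \<in> U)}"

definition filter_gen :: "letter list \<Rightarrow> nat \<Rightarrow> nat set \<Rightarrow> nat set" where
  "filter_gen w n S = snake_le w n `` S"

text \<open>Filters are ordered by reverse inclusion, so the empty filter is the maximum.\<close>

definition filter_le :: "nat set \<Rightarrow> nat set \<Rightarrow> bool" where
  "filter_le U V \<longleftrightarrow> V \<subseteq> U"

definition chain_poly :: "('a \<Rightarrow> 'a \<Rightarrow> bool) \<Rightarrow> 'a set \<Rightarrow> int poly" where
  "chain_poly le A =
     (\<Sum>k\<le>card A. monom (int (card {c. c \<subseteq> A \<and> Complete_Partial_Order.chain le c \<and> card c = k})) k)"

section \<open>Embedding into the integer grid\<close>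

definition axis_point :: "letter \<Rightarrow> int \<Rightarrow> int \<times> int" where
  "axis_point l t = (if l = R then (t, 0) else (0, t))"

text \<open>Position of the smallest filter \<open>\<langle>2m+3\<rangle>\<close>, which depends on the letter following \<open>w\<^sub>m\<close> in the
  full word of length \<open>n\<close>.\<close>

definition bottom_point :: "letter list \<Rightarrow> nat \<Rightarrow> nat \<Rightarrow> int \<times> int" where
  "bottom_point w n m = (if m = n \<or> w ! (m+1) = R then (-1, 0) else (0, -1))"

definition last_diff :: "letter list \<Rightarrow> nat \<Rightarrow> nat" where
  "last_diff w m = Max {k. k < m \<and> w ! k \<noteq> w ! m}"

text \<open>Graph of the embedding after processing the prefix \<open>w\<^sub>0 \<dots> w\<^sub>m\<close> of the word \<open>w\<close> of
  length \<open>n\<close>.\<close>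

fun emb_graph :: "letter list \<Rightarrow> nat \<Rightarrow> nat \<Rightarrow> (nat set \<times> (int \<times> int)) set" where
  "emb_graph w n 0 =
     {({}, (1, 2)),
      (filter_gen w 0 {0}, (1, 1)),
      (filter_gen w 0 {1}, (0, 1)),
      (filter_gen w 0 {2}, (1, 0)),
      (filter_gen w 0 {1, 2}, (0, 0)),
      (filter_gen w 0 {3}, bottom_point w n 0)}"
| "emb_graph w n (Suc m') = (let m = Suc m'; k = last_diff w m; d = int m - int k in
     {(U, (x + 1, y + 1)) | U x y. (U, (x, y)) \<in> emb_graph w n m'}
     \<union> {(filter_gen w m {2*m+2}, axis_point (w ! m) (d + 1)),
        (filter_gen w m {2*m+2, if k = 0 \<and> w ! m = R then 1 else 2*k+2}, axis_point (w ! m) d)}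
     \<union> {(filter_gen w m {2*m+2, 2*k+2*i+1}, axis_point (w ! m) (d - int i)) | i.
          1 \<le> i \<and> i \<le> m - k}
     \<union> {(filter_gen w m {2*m+3}, bottom_point w n m)})"

definition emb :: "letter list \<Rightarrow> nat \<Rightarrow> nat set \<Rightarrow> int \<times> int" where
  "emb w n U = (THE p. (U, p) \<in> emb_graph w n n)"

definition snake_grid :: "letter list \<Rightarrow> nat \<Rightarrow> (int \<times> int) set" where
  "snake_grid w n = emb w n ` snake_filters w n"

definition filters_from :: "letter list \<Rightarrow> nat \<Rightarrow> int \<Rightarrow> int \<Rightarrow> nat set set" where
  "filters_from w n i j =
     {U \<in> snake_filters w n. fst (emb w n U) \<ge> i \<and> snd (emb w n U) \<ge> j}"

section \<open>Valid paths and their weights\<close>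

text \<open>\<open>EStep i j\<close> is $e_{i,j}$ and \<open>HStep k i j\<close> is $h_{i,j}^k$.\<close>

datatype step = EStep int int | HStep nat int int

fun step_source :: "step \<Rightarrow> int \<times> int" where
  "step_source (EStep i j) = (i, j)"
| "step_source (HStep k i j) = (i, j)"

fun step_target :: "step \<Rightarrow> int \<times> int" where
  "step_target (EStep i j) = (i + 1, j)"
| "step_target (HStep k i j) = (i + int k, j + 1)"

text \<open>A step on \<open>J\<close> has to stay on \<open>J\<close>: \<open>HStep k i j\<close> moves along \<open>J\<close> from \<open>(i, j)\<close> to
  \<open>(i + k, j)\<close> and then up, so \<open>(i + k, j)\<close> has to lie in \<open>J\<close>; and it is the alternative to
  \<open>EStep i j\<close>, so \<open>(i, j + 1)\<close> has to lie in \<open>J\<close>. If only \<open>(i + k, j + 1) \<in> J\<close> were required, then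
  already for \<open>n = 0\<close> additional steps such as \<open>(-1, 0)\<close> to \<open>(0, 1)\<close> would be allowed and
  the path weights would add up to \<open>(1+z)\<^sup>2 (1+6z+6z\<^sup>2)\<close> instead of \<open>(1+z)\<^sup>3 (1+2z)\<close>.\<close>

fun step_on :: "(int \<times> int) set \<Rightarrow> step \<Rightarrow> bool" where
  "step_on J (EStep i j) \<longleftrightarrow> (i, j) \<in> J \<and> (i + 1, j) \<in> J \<and> (i, j + 1) \<notin> J"
| "step_on J (HStep k i j) \<longleftrightarrow>
     (i, j) \<in> J \<and> (i + int k, j) \<in> J \<and> (i, j + 1) \<in> J \<and> (i + int k, j + 1) \<in> J"

fun step_weight :: "step \<Rightarrow> int poly" where
  "step_weight (EStep i j) = [:1, 1:]"
| "step_weight (HStep k i j) = (if k = 0 then [:1, 1:] else [:0, 1:] * [:1, 1:] ^ k)"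

fun grid_path :: "(int \<times> int) set \<Rightarrow> int \<times> int \<Rightarrow> step list \<Rightarrow> int \<times> int \<Rightarrow> bool" where
  "grid_path J p [] q \<longleftrightarrow> p \<in> J \<and> p = q"
| "grid_path J p (s # ss) q \<longleftrightarrow>
     step_on J s \<and> step_source s = p \<and> grid_path J (step_target s) ss q"

definition path_weight :: "step list \<Rightarrow> int poly" where
  "path_weight ss = prod_list (map step_weight ss)"

definition path_weight_sum :: "(int \<times> int) set \<Rightarrow> int \<times> int \<Rightarrow> int \<times> int \<Rightarrow> int poly" where
  "path_weight_sum J p q = (\<Sum>ss\<in>{ss. grid_path J p ss q}. path_weight ss)"

text \<open>The sum ranges over a finite set: every step increases the coordinate sum.\<close>

lemma step_on_finite:
  assumes "finite J"
  shows "finite {s. step_on J s}"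
proof -
  have "{s. step_on J s} \<subseteq> (\<lambda>(p, q). if snd p = snd q then EStep (fst p) (snd p)
           else HStep (nat (fst q - fst p)) (fst p) (snd p)) ` (J \<times> J)"
  proof
    fix s assume "s \<in> {s. step_on J s}"
    then have "step_on J s" by simp
    then show "s \<in> (\<lambda>(p, q). if snd p = snd q then EStep (fst p) (snd p)
           else HStep (nat (fst q - fst p)) (fst p) (snd p)) ` (J \<times> J)"
      by (intro image_eqI[where x = "(step_source s, step_target s)"]; cases s) auto
  qed
  with assms show ?thesis by (meson finite_SigmaI finite_imageI finite_subset)
qed

lemma grid_path_length:
  assumes "grid_path J p ss q"
  shows "int (length ss) \<le> fst q + snd q - (fst p + snd p)"
  using assms
proof (induction ss arbitrary: p)
  case (Cons s ss)
  then show ?case by (cases s) force+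
qed simp

lemma finite_grid_paths:
  assumes "finite J"
  shows "finite {ss. grid_path J p ss q}"
proof (rule finite_subset)
  have "set ss \<subseteq> {s. step_on J s}" if "grid_path J p ss q" for ss
    using that
  proof (induction ss arbitrary: p)
    case (Cons s ss)
    from Cons.prems have "step_on J s" "grid_path J (step_target s) ss q" by simp_all
    with Cons.IH[of "step_target s"] show ?case by simp
  qed simp
  then show "{ss. grid_path J p ss q}
      \<subseteq> {ss. set ss \<subseteq> {s. step_on J s} \<and> length ss \<le> nat (fst q + snd q - (fst p + snd p))}"
    using grid_path_length[of J p _ q] by fastforce
  show "finite {ss. set ss \<subseteq> {s. step_on J s} \<and> length ss \<le> nat (fst q + snd q - (fst p + snd p))}"
    using step_on_finite[OF assms] by (rule finite_lists_length_le)
qed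

end

theory Submission
  imports Defs
begin

text \<open>
  The proof separates the geometry of the grid from the combinatorics of the poset.

  \<^bold>\<open>Paths.\<close> For a point \<open>p = (i, j)\<close> of a finite set \<open>J\<close> of grid points let \<open>C(p)\<close> be the chain
  polynomial of the points of \<open>J\<close> weakly above \<open>p\<close>. If \<open>(i, j + 1)\<close> is missing from a convex \<open>J\<close>,
  then every other point above \<open>p\<close> is above \<open>(i + 1, j)\<close>, and \<open>C(p) = (1 + z) C(i + 1, j)\<close> because
  \<open>p\<close> may be added freely to any chain. If \<open>(i, j + 1)\<close> is present, sort the chains by the last
  point \<open>(i + k, j)\<close> that they use in the row of \<open>p\<close>: for \<open>k > 0\<close> they contain that point, any
  subset of the \<open>k\<close> points to its left, and a chain above \<open>(i + k, j + 1)\<close>, which gives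
  \<open>z (1 + z)\<^sup>k C(i + k, j + 1)\<close>; the chains using no point of the row except possibly \<open>p\<close> give
  \<open>(1 + z) C(i, j + 1)\<close>. The factors are the step weights, so \<open>C\<close> obeys the recursion that the path
  weight sums obey by splitting off the first step, and at the top point the two differ by the
  factor \<open>1 + z\<close>. This is \<open>chain_poly_above\<close>; it needs only the few properties of \<open>J\<close> collected in
  the locale \<open>staircase\<close>.

  \<^bold>\<open>Coordinates.\<close> A snake poset is a union of two chains: each pair \<open>2j + 1\<close>, \<open>2j + 2\<close> is distributed
  over them according to the letter \<open>w\<^sub>j\<close>. A filter cuts off an upper end of each chain, and the
  embedding records, up to a shift, how much of each chain lies outside: the coordinates of \<open>U\<close> are \<open>n + 1\<close> and
  \<open>n + 2\<close> minus the number of elements of \<open>U\<close> in the first and in the second chain. With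
  this description the order embedding (\<open>position_le_iff\<close>) and the staircase shape
  (\<open>staircase_positions\<close>) follow from closure properties of filters, without any computation of the
  shape of the grid. That the recursively placed points are these coordinates (\<open>emb_graph_eq\<close>) comes
  from listing the filters that are new at stage \<open>m\<close>: all but the least of them contain \<open>2m + 2\<close> and
  miss, apart from \<open>2m + 3\<close>, only a lower end of one chain, so that one coordinate is \<open>0\<close> and the
  other is the number of missing elements.

  Mirror words give isomorphic posets, by exchanging the labels \<open>1\<close> and \<open>2\<close>.
\<close>

section \<open>Chain polynomials\<close>

definition chains :: "('a \<Rightarrow> 'a \<Rightarrow> bool) \<Rightarrow> 'a set \<Rightarrow> 'a set set" where
  "chains le A = {c. c \<subseteq> A \<and> Complete_Partial_Order.chain le c}"

lemma finite_chains: "finite A \<Longrightarrow> finite (chains le A)"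
  by (rule finite_subset[of _ "Pow A"]) (auto simp: chains_def)

text \<open>Summing over the chains themselves instead of over cardinalities lets bijections between sets of
  chains act termwise.\<close>

lemma chain_poly_eq_sum_chains:
  assumes "finite A"
  shows "chain_poly le A = (\<Sum>c\<in>chains le A. monom 1 (card c))"
proof -
  have "(\<Sum>c\<in>chains le A. monom (1::int) (card c))
      = (\<Sum>k\<le>card A. \<Sum>c\<in>{c \<in> chains le A. card c = k}. monom 1 (card c))"
    by (rule sum.group[symmetric])
      (use assms finite_chains[OF assms] in \<open>auto simp: chains_def intro: card_mono\<close>)
  also have "\<dots> = (\<Sum>k\<le>card A. monom (int (card {c \<in> chains le A. card c = k})) k)"
    by (rule sum.cong) (simp_all add: of_nat_poly monom_altdef smult_monom mult.commute)
  finally show ?thesis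
    by (simp add: chain_poly_def chains_def conj_assoc)
qed

text \<open>A chain through \<open>p\<close> is \<open>p\<close> added to a chain of elements comparable to \<open>p\<close>; the extra element
  accounts for the factor \<open>z\<close>.\<close>

lemma chain_poly_insert:
  assumes "finite S" "p \<notin> S" "le p p"
  shows "chain_poly le (insert p S)
    = chain_poly le S + [:0, 1:] * chain_poly le {q \<in> S. le p q \<or> le q p}"
proof -
  let ?T = "{q \<in> S. le p q \<or> le q p}"
  have split: "chains le (insert p S) = chains le S \<union> insert p ` chains le ?T"
  proof (intro equalityI subsetI)
    fix c assume c: "c \<in> chains le (insert p S)"
    show "c \<in> chains le S \<union> insert p ` chains le ?T"
    proof (cases "p \<in> c")
      case True
      then have "c = insert p (c - {p})" by auto
      moreover from c True have "c - {p} \<in> chains le ?T"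
        by (auto simp: chains_def Complete_Partial_Order.chain_def)
      ultimately show ?thesis by blast
    next
      case False
      with c show ?thesis by (auto simp: chains_def)
    qed
  next
    fix c assume "c \<in> chains le S \<union> insert p ` chains le ?T"
    then show "c \<in> chains le (insert p S)"
      using assms(3) by (fastforce simp: chains_def Complete_Partial_Order.chain_def)
  qed
  have inj: "inj_on (insert p) (chains le ?T)"
    using assms(2) by (auto simp: inj_on_def chains_def dest!: insert_ident[THEN iffD1, rotated 2])
  have "(\<Sum>c\<in>insert p ` chains le ?T. monom (1::int) (card c))
      = (\<Sum>c\<in>chains le ?T. [:0, 1:] * monom 1 (card c))"
  proof (subst sum.reindex[OF inj], rule sum.cong[OF refl])
    fix c assume "c \<in> chains le ?T"
    then have "p \<notin> c" "finite c"
      using assms by (auto simp: chains_def intro: finite_subset)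
    then show "((\<lambda>c. monom (1::int) (card c)) \<circ> insert p) c = [:0, 1:] * monom 1 (card c)"
      by (simp add: monom_Suc)
  qed
  then show ?thesis
    using assms(1,2)
    by (simp add: chain_poly_eq_sum_chains split sum_distrib_left)
      (subst sum.union_disjoint; auto simp: finite_chains chains_def)
qed

lemma chain_poly_insert_comparable:
  assumes "finite S" "p \<notin> S" "le p p" "\<And>q. q \<in> S \<Longrightarrow> le p q \<or> le q p"
  shows "chain_poly le (insert p S) = [:1, 1:] * chain_poly le S"
proof -
  have "{q \<in> S. le p q \<or> le q p} = S" using assms(4) by blast
  moreover have "[:1, 1:] = 1 + [:0, 1::int:]" by (simp add: one_pCons)
  ultimately show ?thesis
    using chain_poly_insert[of S p le, OF assms(1-3)] by (simp only: distrib_right mult_1)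
qed

lemma chain_poly_empty: "chain_poly le {} = 1"
  by (simp add: chain_poly_eq_sum_chains chains_def Complete_Partial_Order.chain_def
      conj_commute cong: conj_cong)

lemma chain_poly_image:
  assumes "finite A" "inj_on f A"
    and "\<And>x y. x \<in> A \<Longrightarrow> y \<in> A \<Longrightarrow> le' (f x) (f y) \<longleftrightarrow> le x y"
  shows "chain_poly le' (f ` A) = chain_poly le A"
proof -
  have chain_image: "Complete_Partial_Order.chain le' (f ` c) \<longleftrightarrow> Complete_Partial_Order.chain le c"
    if "c \<subseteq> A" for c
  proof -
    have "le' (f x) (f y) \<longleftrightarrow> le x y" if "x \<in> c" "y \<in> c" for x y
      using that \<open>c \<subseteq> A\<close> by (intro assms(3)) auto
    then show ?thesis by (simp add: Complete_Partial_Order.chain_def)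
  qed
  have "chains le' (f ` A) = (`) f ` chains le A"
    using chain_image by (auto simp: chains_def subset_image_iff)
  moreover have "inj_on ((`) f) (chains le A)"
    using assms(2) by (intro inj_onI) (auto simp: chains_def inj_on_image_eq_iff)
  moreover have "card (f ` c) = card c" if "c \<in> chains le A" for c
    using that assms(2) by (intro card_image) (auto simp: chains_def intro: inj_on_subset)
  ultimately show ?thesis
    using assms(1) by (simp add: chain_poly_eq_sum_chains sum.reindex)
qed

section \<open>Path weights in staircase-shaped sets\<close>

lemma finite_steps_from: "finite J \<Longrightarrow> finite {s. step_on J s \<and> step_source s = p}"
  by (rule finite_subset[OF _ step_on_finite[of J]]) auto

text \<open>The recursion for weight sums that the chain polynomials will be shown to share.\<close>

lemma path_weight_sum_first_step:
  assumes "finite J" "p \<in> J"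
  shows "path_weight_sum J p q = (if p = q then 1 else 0)
    + (\<Sum>s | step_on J s \<and> step_source s = p.
         step_weight s * path_weight_sum J (step_target s) q)"
proof -
  let ?S = "{s. step_on J s \<and> step_source s = p}"
  let ?P = "\<lambda>p. {ss. grid_path J p ss q}"
  have split: "?P p = (if p = q then {[]} else {})
      \<union> (\<lambda>(s, ss). s # ss) ` (SIGMA s:?S. ?P (step_target s))"
  proof (rule set_eqI)
    fix ss
    show "ss \<in> ?P p \<longleftrightarrow> ss \<in> (if p = q then {[]} else {})
        \<union> (\<lambda>(s, ss). s # ss) ` (SIGMA s:?S. ?P (step_target s))"
      using assms(2) by (cases ss) (auto simp: image_iff)
  qed
  have inj: "inj_on (\<lambda>(s, ss). s # ss) X" for X :: "(step \<times> step list) set"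
    by (auto simp: inj_on_def)
  have fin: "finite (SIGMA s:?S. ?P (step_target s))"
    using finite_steps_from[OF assms(1)] finite_grid_paths[OF assms(1)] by blast
  have "path_weight_sum J p q = (if p = q then 1 else 0)
      + (\<Sum>ss\<in>(\<lambda>(s, ss). s # ss) ` (SIGMA s:?S. ?P (step_target s)). path_weight ss)"
    unfolding path_weight_sum_def split
    by (subst sum.union_disjoint) (use fin in \<open>auto simp: path_weight_def\<close>)
  also have "(\<Sum>ss\<in>(\<lambda>(s, ss). s # ss) ` (SIGMA s:?S. ?P (step_target s)). path_weight ss)
      = (\<Sum>(s, ss)\<in>(SIGMA s:?S. ?P (step_target s)). step_weight s * path_weight ss)"
    by (subst sum.reindex[OF inj]) (auto intro!: sum.cong simp: path_weight_def)
  also have "\<dots> = (\<Sum>s\<in>?S. \<Sum>ss\<in>?P (step_target s). step_weight s * path_weight ss)"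
    by (rule sum.Sigma[symmetric])
      (use finite_steps_from[OF assms(1)] finite_grid_paths[OF assms(1)] in auto)
  finally show ?thesis
    by (simp add: path_weight_sum_def sum_distrib_left)
qed

definition grid_le :: "int \<times> int \<Rightarrow> int \<times> int \<Rightarrow> bool" where
  "grid_le p q \<longleftrightarrow> fst p \<le> fst q \<and> snd p \<le> snd q"

text \<open>Convexity of columns forces the points above a point without a northern neighbour to lie above its
  eastern neighbour. Convexity of rows makes the points that a chain can use in a row an interval, and
  join closure puts \<open>(i + k, j + 1)\<close> into \<open>J\<close> as soon as \<open>(i + k, j)\<close> and \<open>(i, j + 1)\<close> are in \<open>J\<close>. The
  last condition excludes dead ends below the top.\<close>

locale staircase =
  fixes J :: "(int \<times> int) set" and top :: "int \<times> int"
  assumes finite_J: "finite J"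
    and top_in: "top \<in> J"
    and top_max: "p \<in> J \<Longrightarrow> grid_le p top"
    and row_convex: "(x, y) \<in> J \<Longrightarrow> (x', y) \<in> J \<Longrightarrow> x \<le> t \<Longrightarrow> t \<le> x' \<Longrightarrow> (t, y) \<in> J"
    and column_convex: "(x, y) \<in> J \<Longrightarrow> (x, y') \<in> J \<Longrightarrow> y \<le> t \<Longrightarrow> t \<le> y' \<Longrightarrow> (x, t) \<in> J"
    and join_closed: "(x, y) \<in> J \<Longrightarrow> (x', y') \<in> J \<Longrightarrow> (max x x', max y y') \<in> J"
    and upward_step: "(x, y) \<in> J \<Longrightarrow> (x, y) \<noteq> top \<Longrightarrow> (x + 1, y) \<in> J \<or> (x, y + 1) \<in> J"
begin

definition above :: "int \<times> int \<Rightarrow> (int \<times> int) set" where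
  "above p = {q \<in> J. grid_le p q}"

lemma finite_above: "finite (above p)"
  using finite_J by (simp add: above_def)

lemma chain_poly_above_top: "chain_poly grid_le (above top) = [:1, 1:]"
proof -
  have "q = top" if "q \<in> J" "grid_le top q" for q
    using top_max[OF that(1)] that(2) by (simp add: grid_le_def prod_eq_iff)
  then have "above top = insert top {}"
    using top_in by (auto simp: above_def grid_le_def)
  moreover have "chain_poly grid_le (insert top {}) = [:1, 1:] * chain_poly grid_le {}"
    by (rule chain_poly_insert_comparable) (auto simp: grid_le_def)
  ultimately show ?thesis by (simp add: chain_poly_empty)
qed

text \<open>By convexity of the column, the missing northern neighbour cuts off the rest of the column.\<close>

lemma chain_poly_above_east:
  assumes p: "(i, j) \<in> J" and north: "(i, j + 1) \<notin> J"
  shows "chain_poly grid_le (above (i, j)) = [:1, 1:] * chain_poly grid_le (above (i + 1, j))"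
proof -
  have "i + 1 \<le> fst q" if q: "q \<in> J" "grid_le (i, j) q" "q \<noteq> (i, j)" for q
  proof (rule ccontr)
    assume "\<not> i + 1 \<le> fst q"
    with q obtain y where "q = (i, y)" "j + 1 \<le> y" by (cases q) (auto simp: grid_le_def)
    with column_convex[OF p, of y "j + 1"] q north show False by simp
  qed
  then have "above (i, j) = insert (i, j) (above (i + 1, j))"
    using p by (fastforce simp: above_def grid_le_def)
  moreover have "chain_poly grid_le (insert (i, j) (above (i + 1, j)))
      = [:1, 1:] * chain_poly grid_le (above (i + 1, j))"
    by (rule chain_poly_insert_comparable[OF finite_above])
      (auto simp: above_def grid_le_def)
  ultimately show ?thesis by simp
qed

text \<open>The points of the row segment are comparable to each other and to all of \<open>T\<close>, so each of them is
  independently present or absent in a chain.\<close>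

lemma chain_poly_row_below:
  assumes "finite T" and "\<And>q. q \<in> T \<Longrightarrow> i + int t \<le> fst q + 1 \<and> j < snd q"
  shows "chain_poly grid_le ((\<lambda>s. (i + int s, j)) ` {..<t} \<union> T)
    = [:1, 1:] ^ t * chain_poly grid_le T"
  using assms(2)
proof (induction t)
  case (Suc t)
  have "chain_poly grid_le (insert (i + int t, j) ((\<lambda>s. (i + int s, j)) ` {..<t} \<union> T))
      = [:1, 1:] * chain_poly grid_le ((\<lambda>s. (i + int s, j)) ` {..<t} \<union> T)"
    by (rule chain_poly_insert_comparable)
      (use assms(1) Suc.prems in \<open>fastforce simp: grid_le_def\<close>)+
  moreover have "chain_poly grid_le ((\<lambda>s. (i + int s, j)) ` {..<t} \<union> T)
      = [:1, 1:] ^ t * chain_poly grid_le T"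
    by (rule Suc.IH) (use Suc.prems in fastforce)
  ultimately show ?case
    by (simp only: lessThan_Suc image_insert Un_insert_left power_Suc mult.assoc)
qed simp

text \<open>The points of the row are added from left to right. Adding \<open>(i + k, j)\<close> contributes the chains in
  which it is the last point of the row; such a chain continues above \<open>(i + k, j + 1)\<close>, which is why
  the weight of the step \<open>HStep k i j\<close> appears.\<close>

lemma chain_poly_row_union:
  assumes "(i, j + 1) \<in> J"
  shows "chain_poly grid_le ((\<lambda>s. (i + int s, j)) ` {..<Suc t} \<union> above (i, j + 1))
    = (\<Sum>k<Suc t. step_weight (HStep k i j) * chain_poly grid_le (above (i + int k, j + 1)))"
proof (induction t)
  case 0
  have "chain_poly grid_le (insert (i, j) (above (i, j + 1)))
      = [:1, 1:] * chain_poly grid_le (above (i, j + 1))"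
    by (rule chain_poly_insert_comparable[OF finite_above])
      (auto simp: above_def grid_le_def)
  then show ?case by (simp add: lessThan_Suc)
next
  case (Suc t)
  let ?R = "(\<lambda>s. (i + int s, j)) ` {..<Suc t}" and ?p = "(i + int (Suc t), j)"
  have "chain_poly grid_le (insert ?p (?R \<union> above (i, j + 1)))
      = chain_poly grid_le (?R \<union> above (i, j + 1))
        + [:0, 1:] * chain_poly grid_le
            {q \<in> ?R \<union> above (i, j + 1). grid_le ?p q \<or> grid_le q ?p}"
    by (rule chain_poly_insert)
      (use finite_above in \<open>auto simp: above_def grid_le_def\<close>)
  also have "{q \<in> ?R \<union> above (i, j + 1). grid_le ?p q \<or> grid_le q ?p}
      = ?R \<union> above (i + int (Suc t), j + 1)"
    by (auto simp: above_def grid_le_def)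
  also have "chain_poly grid_le (?R \<union> above (i + int (Suc t), j + 1))
      = [:1, 1:] ^ Suc t * chain_poly grid_le (above (i + int (Suc t), j + 1))"
    by (rule chain_poly_row_below[OF finite_above]) (auto simp: above_def grid_le_def)
  finally show ?case
    by (simp only: lessThan_Suc[of "Suc t"] image_insert Un_insert_left Suc.IH)
      (simp add: add.commute mult.assoc)
qed

lemma chain_poly_above_north:
  assumes p: "(i, j) \<in> J" and north: "(i, j + 1) \<in> J"
  shows "chain_poly grid_le (above (i, j))
    = (\<Sum>k | (i + int k, j) \<in> J.
         step_weight (HStep k i j) * chain_poly grid_le (above (i + int k, j + 1)))"
proof -
  let ?K = "{k. (i + int k, j) \<in> J}"
  have "finite ((\<lambda>k. (i + int k, j)) -` J)"
    by (rule finite_vimageI[OF finite_J]) (auto simp: inj_on_def)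
  then have fin: "finite ?K" by (simp add: vimage_def)
  have down: "k \<in> ?K" if "k' \<in> ?K" "k \<le> k'" for k k'
    using row_convex[OF p, of "i + int k'" "i + int k"] that by simp
  have "0 \<in> ?K" using p by simp
  then have "Max ?K \<in> ?K" by (intro Max_in[OF fin]) blast
  have K: "?K = {..<Suc (Max ?K)}"
  proof (intro equalityI subsetI)
    fix k assume "k \<in> ?K"
    with Max_ge[OF fin this] show "k \<in> {..<Suc (Max ?K)}" by simp
  next
    fix k assume "k \<in> {..<Suc (Max ?K)}"
    then show "k \<in> ?K"
      by (intro down[OF \<open>Max ?K \<in> ?K\<close>]) (simp only: lessThan_iff less_Suc_eq_le)
  qed
  have "above (i, j) = (\<lambda>s. (i + int s, j)) ` ?K \<union> above (i, j + 1)" (is "_ = ?rhs")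
  proof (intro equalityI subsetI)
    fix q assume q: "q \<in> above (i, j)"
    obtain x y where xy: "q = (x, y)" by (cases q)
    show "q \<in> ?rhs"
    proof (cases "y = j")
      case True
      with q xy have "q = (i + int (nat (x - i)), j)" "nat (x - i) \<in> ?K"
        by (auto simp: above_def grid_le_def)
      then show ?thesis by blast
    qed (use q xy in \<open>auto simp: above_def grid_le_def\<close>)
  qed (auto simp: above_def grid_le_def)
  with chain_poly_row_union[OF north, of "Max ?K"] K show ?thesis by simp
qed

text \<open>Chain polynomials and path weight sums obey the same recursion; the induction is on the distance to
  the top point.\<close>

theorem chain_poly_above:
  assumes "p \<in> J"
  shows "chain_poly grid_le (above p) = path_weight_sum J p top * [:1, 1:]"
  using assms
proof (induction "nat (fst top + snd top - fst p - snd p)" arbitrary: p rule: less_induct)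
  case less
  obtain i j where ij: "p = (i, j)" by (cases p)
  have IH: "chain_poly grid_le (above q) = path_weight_sum J q top * [:1, 1:]"
    if "q \<in> J" "fst p + snd p < fst q + snd q" for q
    using that top_max[of q] by (intro less.hyps) (auto simp: grid_le_def)
  let ?S = "{s. step_on J s \<and> step_source s = p}"
  note W = path_weight_sum_first_step[OF finite_J less.prems, of top]
  show ?case
  proof (cases "p = top")
    case True
    have "s \<notin> ?S" for s
      using True ij top_max by (cases s) (fastforce simp: grid_le_def)+
    then have "?S = {}" by blast
    then have "path_weight_sum J p top = 1"
      unfolding W \<open>?S = {}\<close> using True by simp
    with True chain_poly_above_top show ?thesis by simp
  next
    case notop: False
    show ?thesis
    proof (cases "(i, j + 1) \<in> J")
      case False
      with upward_step less.prems notop ij have east: "(i + 1, j) \<in> J" by blast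
      have "s \<in> ?S \<longleftrightarrow> s = EStep i j" for s
        using False east less.prems ij by (cases s) auto
      then have "?S = {EStep i j}" by blast
      with W notop have "path_weight_sum J p top = [:1, 1:] * path_weight_sum J (i + 1, j) top"
        by simp
      with chain_poly_above_east[of i j] IH[of "(i + 1, j)"] False east less.prems ij
      show ?thesis by (simp only: mult.assoc) simp
    next
      case True
      \<comment> \<open>this point is the join of \<open>(i + k, j)\<close> and \<open>(i, j + 1)\<close>\<close>
      have ne: "(i + int k, j + 1) \<in> J" if "(i + int k, j) \<in> J" for k
        using join_closed[OF that True] by (simp add: max_def split: if_splits)
      have "s \<in> ?S \<longleftrightarrow> s \<in> (\<lambda>k. HStep k i j) ` {k. (i + int k, j) \<in> J}" for s
        using True less.prems ij ne by (cases s) auto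
      then have "?S = (\<lambda>k. HStep k i j) ` {k. (i + int k, j) \<in> J}" by blast
      with W notop have "path_weight_sum J p top = (\<Sum>k | (i + int k, j) \<in> J.
          step_weight (HStep k i j) * path_weight_sum J (i + int k, j + 1) top)"
        by (simp add: sum.reindex inj_on_def del: step_weight.simps)
      moreover have "chain_poly grid_le (above p) = (\<Sum>k | (i + int k, j) \<in> J.
          step_weight (HStep k i j) * (path_weight_sum J (i + int k, j + 1) top * [:1, 1:]))"
        unfolding ij by (subst chain_poly_above_north[OF less.prems[unfolded ij] True])
          (intro sum.cong refl arg_cong[of _ _ "times _"] IH, use ne ij in auto)
      ultimately show ?thesis
        by (simp only: sum_distrib_right mult.assoc)
    qed
  qed
qed

end

section \<open>Filters of generalized snake posets\<close>

text \<open>The unique element covering \<open>2m + 2\<close>, for \<open>m \<ge> 1\<close>. The empty letter before \<open>w\<^sub>1\<close> acts as if it were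
  an \<open>R\<close>.\<close>

definition even_cover :: "letter list \<Rightarrow> nat \<Rightarrow> nat" where
  "even_cover w m = (if w ! m = w ! (m - 1) \<or> m = 1 \<and> w ! m = R then 2 * m else 2 * m - 1)"

text \<open>The upper covers of a label do not change when the word is extended. Hence the filters of all
  prefixes are described by the single notion \<open>up_closed\<close>.\<close>

definition upper_covers :: "letter list \<Rightarrow> nat \<Rightarrow> nat set" where
  "upper_covers w x =
     (if x = 0 then {} else if x \<le> 2 then {0}
      else if odd x then {x - 2, x - 1} else {even_cover w (x div 2 - 1)})"

definition up_closed :: "letter list \<Rightarrow> nat set \<Rightarrow> bool" where
  "up_closed w U \<longleftrightarrow> (\<forall>x\<in>U. upper_covers w x \<subseteq> U)"

lemma upper_covers_simps [simp]:
  "upper_covers w 0 = {}"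
  "upper_covers w (Suc 0) = {0}"
  "upper_covers w 2 = {0}"
  "upper_covers w (2 * m + 3) = {2 * m + 1, 2 * m + 2}"
  "upper_covers w (2 * m + 4) = {even_cover w (Suc m)}"
  by (auto simp: upper_covers_def)

lemma nat_snake_cases:
  fixes x :: nat
  obtains "x = 0" | "x = 1" | "x = 2" | m where "x = 2 * m + 3" | m where "x = 2 * m + 4"
proof -
  consider "x < 3" | "3 \<le> x" "odd x" | "3 \<le> x" "even x" by linarith
  then show ?thesis
  proof cases
    case 1
    then have "x = 0 \<or> x = 1 \<or> x = 2" by auto
    with that show ?thesis by blast
  next
    case 2
    then obtain k where "x = 2 * k + 1" "1 \<le> k" by (auto elim!: oddE)
    then have "x = 2 * (k - 1) + 3" by simp
    with that show ?thesis by blast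
  next
    case 3
    then obtain k where "x = 2 * k" "2 \<le> k" by (auto elim!: evenE)
    then have "x = 2 * (k - 2) + 4" by simp
    with that show ?thesis by blast
  qed
qed

lemma upper_covers_less: "y \<in> upper_covers w x \<Longrightarrow> y < x"
  by (cases x rule: nat_snake_cases) (auto simp: even_cover_def split: if_splits)

lemma up_closed_empty: "up_closed w {}"
  and up_closed_Int: "up_closed w U \<Longrightarrow> up_closed w V \<Longrightarrow> up_closed w (U \<inter> V)"
  and up_closed_Un: "up_closed w U \<Longrightarrow> up_closed w V \<Longrightarrow> up_closed w (U \<union> V)"
  and up_closed_insert: "up_closed w U \<Longrightarrow> upper_covers w x \<subseteq> U \<Longrightarrow> up_closed w (insert x U)"
  by (auto simp: up_closed_def)

lemma up_closedD: "up_closed w U \<Longrightarrow> x \<in> U \<Longrightarrow> y \<in> upper_covers w x \<Longrightarrow> y \<in> U"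
  by (auto simp: up_closed_def)

lemma up_closed_atMost: "up_closed w {..t}"
  using upper_covers_less by (fastforce simp: up_closed_def)

text \<open>Elements below a given one have larger labels. So an element below the largest label of \<open>V - U\<close> would
  lie in \<open>U\<close>, and then \<open>U\<close> would contain that label too.\<close>

lemma up_closed_remove_Max:
  assumes "up_closed w U" "up_closed w V" "finite V" "U \<subset> V"
  shows "up_closed w (V - {Max (V - U)})"
  unfolding up_closed_def
proof (intro ballI subsetI)
  fix x y assume x: "x \<in> V - {Max (V - U)}" and y: "y \<in> upper_covers w x"
  have "y \<noteq> Max (V - U)"
  proof
    assume eq: "y = Max (V - U)"
    have "Max (V - U) \<in> V - U"
      using assms(3,4) by (intro Max_in) auto
    moreover have "x \<notin> V - U"
      using upper_covers_less[OF y] Max_ge[of "V - U" x] assms(3) eq by fastforce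
    ultimately show False
      using x y eq assms(1) by (auto dest: up_closedD)
  qed
  with x y assms(2) show "y \<in> V - {Max (V - U)}" by (auto dest: up_closedD)
qed

text \<open>Removing the largest label of the difference repeatedly passes through every cardinality. This is
  the source of the convexity of the grid.\<close>

lemma up_closed_between:
  assumes "up_closed w U" "up_closed w V" "finite V" "U \<subseteq> V" "card U \<le> k" "k \<le> card V"
  shows "\<exists>W. up_closed w W \<and> U \<subseteq> W \<and> W \<subseteq> V \<and> card W = k"
  using assms
proof (induction "card V" arbitrary: V rule: less_induct)
  case less
  show ?case
  proof (cases "k = card V")
    case False
    let ?a = "Max (V - U)"
    from False less.prems have "U \<subset> V" by auto
    then have a: "?a \<in> V - U" using less.prems by (intro Max_in) auto
    then have "card (V - {?a}) < card V" "k \<le> card (V - {?a})"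
      using less.prems False by (auto simp: card_Diff_singleton intro: card_Diff1_less)
    with a less.hyps[of "V - {?a}"] up_closed_remove_Max[OF less.prems(1-3) \<open>U \<subset> V\<close>] less.prems
    show ?thesis by fastforce
  qed (use less.prems in blast)
qed

text \<open>For \<open>j \<ge> 1\<close> the label \<open>2j + 1\<close> is the minimum of the poset of a prefix.\<close>

lemma up_closed_odd:
  assumes "up_closed w U" "2 * j + 1 \<in> U"
  shows "{..2 * j + 1} \<subseteq> U"
  using assms(2)
proof (induction j)
  case 0
  with up_closedD[OF assms(1), of 1 0] show ?case by (auto simp: atMost_Suc)
next
  case (Suc j)
  then have top: "2 * j + 3 \<in> U" by (simp add: numeral_3_eq_3)
  then have "2 * j + 1 \<in> U" "2 * j + 2 \<in> U"
    by (rule up_closedD[OF assms(1)]; simp only: upper_covers_simps; simp)+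
  with Suc.IH top show ?case
    by (auto simp: atMost_Suc numeral_3_eq_3)
qed

locale snake =
  fixes n :: nat and w :: "letter list"
  assumes word: "snake_word n w"
begin

lemma first_letter: "w ! 0 = Eps"
  and letters: "1 \<le> j \<Longrightarrow> j \<le> n \<Longrightarrow> w ! j = L \<or> w ! j = R"
  using word by (auto simp: snake_word_def)

lemma snake_covers_iff:
  "m \<le> n \<Longrightarrow> (x, y) \<in> snake_covers w m \<longleftrightarrow> x \<le> 2 * m + 3 \<and> y \<in> upper_covers w x"
proof (induction m)
  case 0
  consider "x = 0" | "x = 1" | "x = 2" | "x = 3" | "3 < x" by linarith
  then show ?case by cases (auto simp: upper_covers_def)
next
  case (Suc m)
  let ?m = "Suc m"
  have num: "2 * ?m + 3 = 2 * m + 5" "2 * ?m + 2 = 2 * m + 4" "2 * ?m + 1 = 2 * m + 3"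
    by simp_all
  have "(if ?m = 1 \<and> w ! 1 = L \<or> ?m \<ge> 2 \<and> (w ! (?m - 1), w ! ?m) \<in> {(R, L), (L, R)}
         then {(2 * ?m + 2, 2 * ?m - 1)} else {})
      \<union> (if ?m = 1 \<and> w ! 1 = R \<or> ?m \<ge> 2 \<and> (w ! (?m - 1), w ! ?m) \<in> {(L, L), (R, R)}
         then {(2 * ?m + 2, 2 * ?m)} else {}) = {(2 * ?m + 2, even_cover w ?m)}"
  proof (cases m)
    case 0
    with letters[of 1] Suc.prems have "w ! 1 = L \<or> w ! 1 = R" by simp
    with 0 first_letter show ?thesis by (elim disjE) (simp_all add: even_cover_def)
  next
    case Suc': (Suc m')
    with letters[of m] letters[of ?m] Suc.prems
    have "w ! m = L \<or> w ! m = R" "w ! ?m = L \<or> w ! ?m = R" by simp_all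
    with Suc' show ?thesis by (elim disjE) (simp_all add: even_cover_def)
  qed
  then have last: "(x, y) \<in> snake_covers w ?m \<longleftrightarrow> (x, y) \<in> snake_covers w m
      \<or> x = 2 * m + 5 \<and> y \<in> {2 * m + 3, 2 * m + 4} \<or> x = 2 * m + 4 \<and> y = even_cover w ?m"
    unfolding snake_covers.simps Let_def Un_assoc num by blast
  have covers: "upper_covers w (2 * m + 5) = {2 * m + 3, 2 * m + 4}"
    "upper_covers w (2 * m + 4) = {even_cover w (Suc m)}"
    using upper_covers_simps(4)[of w "Suc m"] upper_covers_simps(5)[of w m]
    by (simp_all add: eval_nat_numeral)
  have IH: "(x, y) \<in> snake_covers w m \<longleftrightarrow> x \<le> 2 * m + 3 \<and> y \<in> upper_covers w x"
    using Suc by simp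
  consider "x \<le> 2 * m + 3" | "x = 2 * m + 4" | "x = 2 * m + 5" | "2 * m + 5 < x"
    by linarith
  then show ?case
    unfolding last IH by cases (simp_all add: covers)
qed

lemma snake_filters_iff:
  assumes "m \<le> n"
  shows "U \<in> snake_filters w m \<longleftrightarrow> U \<subseteq> {..2 * m + 3} \<and> up_closed w U"
proof
  assume U: "U \<in> snake_filters w m"
  then have sub: "U \<subseteq> {..2 * m + 3}"
    by (auto simp: snake_filters_def snake_elems_def)
  moreover have "up_closed w U"
    unfolding up_closed_def
  proof (intro ballI subsetI)
    fix x y assume "x \<in> U" "y \<in> upper_covers w x"
    with sub have "(x, y) \<in> snake_covers w m"
      by (auto simp: snake_covers_iff[OF assms])
    then have "(x, y) \<in> snake_le w m" by (simp add: snake_le_def r_into_rtrancl)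
    with U \<open>x \<in> U\<close> show "y \<in> U" by (auto simp: snake_filters_def)
  qed
  ultimately show "U \<subseteq> {..2 * m + 3} \<and> up_closed w U" by blast
next
  assume U: "U \<subseteq> {..2 * m + 3} \<and> up_closed w U"
  have "y \<in> U" if "(x, y) \<in> snake_le w m" "x \<in> U" for x y
    using that unfolding snake_le_def
    by induction (use U snake_covers_iff[OF assms] in \<open>auto dest: up_closedD\<close>)
  with U show "U \<in> snake_filters w m"
    by (auto simp: snake_filters_def snake_elems_def)
qed

text \<open>Generated filters are recognized as least closed sets, without computing the transitive closure of
  the cover relation.\<close>

lemma filter_gen_eqI:
  assumes "m \<le> n" "X \<subseteq> {..2 * m + 3}" "up_closed w X" "S \<subseteq> X"
    and least: "\<And>V. up_closed w V \<Longrightarrow> S \<subseteq> V \<Longrightarrow> X \<subseteq> V"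
  shows "filter_gen w m S = X"
proof
  have "X \<in> snake_filters w m" using assms snake_filters_iff by blast
  with assms(4) show sub: "filter_gen w m S \<subseteq> X"
    by (auto simp: filter_gen_def snake_filters_def)
  show "X \<subseteq> filter_gen w m S"
  proof (rule least)
    show "S \<subseteq> filter_gen w m S" by (auto simp: filter_gen_def snake_le_def)
    show "up_closed w (filter_gen w m S)"
      unfolding up_closed_def
    proof (intro ballI subsetI)
      fix x y assume x: "x \<in> filter_gen w m S" and "y \<in> upper_covers w x"
      with sub assms(2) have "(x, y) \<in> snake_covers w m"
        by (auto simp: snake_covers_iff[OF assms(1)])
      with x show "y \<in> filter_gen w m S"
        by (auto simp: filter_gen_def snake_le_def intro: rtrancl_into_rtrancl)
    qed
  qed
qed

section \<open>The two chains behind the coordinates\<close>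

text \<open>One of the two chains into which the poset splits; its complement among the labels is the other
  one. For \<open>1 \<le> j \<le> n\<close> the pair \<open>2j + 1\<close>, \<open>2j + 2\<close> contributes its odd label to this chain if \<open>w\<^sub>j = R\<close>
  and its even label otherwise; the indices \<open>0\<close> and \<open>n + 1\<close> are treated like the letter \<open>R\<close>. The
  pair index of \<open>x\<close> is \<open>(x - 1) div 2\<close>, and the label \<open>0\<close>, to which truncated subtraction assigns
  the index \<open>0\<close>, falls into the complement.\<close>

definition first_chain :: "nat set" where
  "first_chain = {x. odd x \<longleftrightarrow> (let j = (x - 1) div 2 in j = 0 \<or> n < j \<or> w ! j = R)}"

lemma first_chain_simps:
  "0 \<notin> first_chain"
  "2 * j + 1 \<in> first_chain \<longleftrightarrow> j = 0 \<or> n < j \<or> w ! j = R"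
  "2 * j + 2 \<in> first_chain \<longleftrightarrow> \<not> (j = 0 \<or> n < j \<or> w ! j = R)"
  by (simp_all add: first_chain_def)

lemma even_cover_same_chain:
  assumes "Suc m \<le> n"
  shows "even_cover w (Suc m) \<in> first_chain \<longleftrightarrow> 2 * m + 4 \<in> first_chain"
  using assms letters[of "Suc m"] letters[of m] first_letter
    first_chain_simps(2,3)[of m] first_chain_simps(3)[of "Suc m"]
  by (cases "m = 0") (auto simp: even_cover_def eval_nat_numeral)

text \<open>Each element is covered by the next one of its own chain: an odd label is covered by both labels of
  the preceding pair, and an even label by the one in its chain. Hence inside each chain the order
  is the reverse of the numerical one.\<close>

lemma same_chain_up_closed:
  assumes U: "up_closed w U"
  shows "x \<in> U \<Longrightarrow> x \<le> 2 * n + 3 \<Longrightarrow> y < x \<Longrightarrow> y \<in> first_chain \<longleftrightarrow> x \<in> first_chain \<Longrightarrow> y \<in> U"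
proof (induction x rule: less_induct)
  case (less x)
  note fc = first_chain_simps
  show ?case
  proof (cases x rule: nat_snake_cases)
    case 1
    with less.prems show ?thesis by simp
  next
    case 2
    with less.prems up_closedD[OF U, of 1 0] show ?thesis by simp
  next
    case 3
    have "1 \<in> first_chain" "2 \<notin> first_chain"
      using fc(2,3)[of 0] by (simp_all add: numeral_2_eq_2)
    then have "y \<noteq> 1" using less.prems(4) 3 by metis
    then have "y = 0" using less.prems(3) 3 by linarith
    then show ?thesis using up_closedD[OF U, of 2 0] less.prems(1) 3 by simp
  next
    case (4 m)
    then have mem: "2 * m + 1 \<in> U" "2 * m + 2 \<in> U"
      using up_closedD[OF U less.prems(1)] by auto
    obtain z where z: "z = 2 * m + 1 \<or> z = 2 * m + 2" "z \<in> first_chain \<longleftrightarrow> x \<in> first_chain"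
      using fc(2,3)[of m] by metis
    then have "z \<in> U" "z < x" using mem 4 by auto
    consider "y < z" | "y = 2 * m + 1" | "y = 2 * m + 2"
      using less.prems(3) 4 z(1) by linarith
    then show ?thesis
    proof cases
      case 1
      show ?thesis
        by (rule less.IH[of z]) (use \<open>z \<in> U\<close> \<open>z < x\<close> 1 less.prems(2,4) z(2) in simp_all)
    qed (use mem in simp_all)
  next
    case (5 m)
    let ?z = "even_cover w (Suc m)"
    have z: "?z = 2 * m + 1 \<or> ?z = 2 * m + 2" by (auto simp: even_cover_def)
    have same: "?z \<in> first_chain \<longleftrightarrow> x \<in> first_chain"
      unfolding 5 by (rule even_cover_same_chain) (use less.prems(2) 5 in simp)
    have "?z \<in> U" "?z < x" using up_closedD[OF U less.prems(1), of ?z] 5 z by auto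
    have "2 * m + 3 \<in> first_chain \<longleftrightarrow> x \<notin> first_chain"
      using fc(2,3)[of "Suc m"] by (simp add: 5 eval_nat_numeral)
    with less.prems(4) have "y \<noteq> 2 * m + 3" by blast
    moreover have "2 * m + 1 \<in> first_chain \<longleftrightarrow> 2 * m + 2 \<notin> first_chain"
      using fc(2,3)[of m] by blast
    then have "\<not> (?z = 2 * m + 1 \<and> y = 2 * m + 2)"
      using same less.prems(4) by metis
    ultimately have "y < ?z \<or> y = ?z"
      using less.prems(3) 5 z by linarith
    then show ?thesis
    proof
      assume "y < ?z"
      show ?thesis
        by (rule less.IH[of ?z])
          (use \<open>?z \<in> U\<close> \<open>?z < x\<close> \<open>y < ?z\<close> less.prems(2,4) same in simp_all)
    qed (use \<open>?z \<in> U\<close> in simp)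
  qed
qed

abbreviation filters :: "nat set set" where
  "filters \<equiv> snake_filters w n"

lemma filtersD:
  assumes "U \<in> filters"
  shows "U \<subseteq> {..2 * n + 3}" "up_closed w U" "finite U"
  using assms snake_filters_iff[of n U] finite_subset[of U "{..2 * n + 3}"] by auto

lemma finite_filters: "finite filters"
  by (rule finite_subset[of _ "Pow {..2 * n + 3}"]) (use filtersD in auto)

text \<open>On each chain, filters are initial segments with respect to the labels.\<close>

lemma filters_nested:
  assumes "U \<in> filters" "V \<in> filters"
  shows "U \<inter> first_chain \<subseteq> V \<or> V \<inter> first_chain \<subseteq> U"
    and "U - first_chain \<subseteq> V \<or> V - first_chain \<subseteq> U"
proof -
  have "y \<in> V \<or> x \<in> U"
    if "y \<in> U" "x \<in> V" "y \<in> first_chain \<longleftrightarrow> x \<in> first_chain" for x y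
    using that same_chain_up_closed[of U y x] same_chain_up_closed[of V x y]
      filtersD[OF assms(1)] filtersD[OF assms(2)]
    by (metis atMost_iff linorder_neqE_nat subset_iff)
  then show "U \<inter> first_chain \<subseteq> V \<or> V \<inter> first_chain \<subseteq> U"
    and "U - first_chain \<subseteq> V \<or> V - first_chain \<subseteq> U"
    by blast+
qed

text \<open>Taking \<open>m\<close> in place of \<open>n\<close> describes the intermediate stages of the embedding: passing from
  \<open>m\<close> to \<open>m + 1\<close> is the shift by \<open>(1, 1)\<close>.\<close>

definition position :: "nat \<Rightarrow> nat set \<Rightarrow> int \<times> int" where
  "position m U =
     (int m + 1 - int (card (U \<inter> first_chain)), int m + 2 - int (card (U - first_chain)))"

text \<open>On each chain the traces of two filters are nested, so comparing their sizes decides inclusion.\<close>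

lemma position_le_iff:
  assumes U: "U \<in> filters" and V: "V \<in> filters"
  shows "grid_le (position n U) (position n V) \<longleftrightarrow> V \<subseteq> U"
proof
  assume le: "grid_le (position n U) (position n V)"
  have fin: "finite (U \<inter> first_chain)" "finite (U - first_chain)"
    "finite (V \<inter> first_chain)" "finite (V - first_chain)"
    using filtersD(3)[OF U] filtersD(3)[OF V] by auto
  from le have card: "card (V \<inter> first_chain) \<le> card (U \<inter> first_chain)"
    "card (V - first_chain) \<le> card (U - first_chain)"
    by (auto simp: grid_le_def position_def)
  have "V \<inter> first_chain \<subseteq> U"
    using filters_nested(1)[OF U V] card_seteq[OF fin(3) _ card(1)] card(1) by blast
  moreover have "V - first_chain \<subseteq> U"
    using filters_nested(2)[OF U V] card_seteq[OF fin(4) _ card(2)] by blast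
  ultimately show "V \<subseteq> U" by blast
next
  assume "V \<subseteq> U"
  then have "card (V \<inter> first_chain) \<le> card (U \<inter> first_chain)"
    "card (V - first_chain) \<le> card (U - first_chain)"
    using filtersD(3)[OF U] by (auto intro!: card_mono)
  then show "grid_le (position n U) (position n V)"
    by (auto simp: grid_le_def position_def)
qed

lemma inj_position: "inj_on (position n) filters"
proof (rule inj_onI)
  fix U V assume "U \<in> filters" "V \<in> filters" "position n U = position n V"
  with position_le_iff[of U V] position_le_iff[of V U] show "U = V"
    by (auto simp: grid_le_def)
qed

text \<open>Each pair \<open>2i + 1\<close>, \<open>2i + 2\<close> has one member in either chain, and \<open>0\<close> is in the second one.\<close>

lemma card_first_chain:
  "card ({..2 * j} \<inter> first_chain) = j" "card ({..2 * j} - first_chain) = j + 1"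
proof (induction j)
  case 0
  have "{..2 * 0} \<inter> first_chain = {}" "{..2 * 0} - first_chain = {0}"
    using first_chain_simps(1) by auto
  then show "card ({..2 * 0} \<inter> first_chain) = 0" "card ({..2 * 0} - first_chain) = 0 + 1"
    by simp_all
next
  case (Suc j)
  have "{..2 * Suc j} = insert (2 * j + 2) (insert (2 * j + 1) {..2 * j})" by auto
  then show "card ({..2 * Suc j} \<inter> first_chain) = Suc j"
    "card ({..2 * Suc j} - first_chain) = Suc j + 1"
    using Suc first_chain_simps(2,3)[of j]
    by (auto simp: Int_insert_left insert_Diff_if simp del: mult_Suc_right)
qed

lemma position_full:
  assumes "m \<le> n"
  shows "position m {..2 * m + 3} = bottom_point w n m"
proof -
  have "{..2 * m + 3} = insert (2 * m + 3) {..2 * Suc m}" by auto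
  moreover have "2 * m + 3 \<in> first_chain \<longleftrightarrow> m = n \<or> w ! (m + 1) = R"
    using first_chain_simps(2)[of "Suc m"] assms by (auto simp: eval_nat_numeral)
  moreover have "2 * m + 3 \<notin> {..2 * Suc m}" by simp
  ultimately show ?thesis
    using card_first_chain[of "Suc m"]
    by (simp add: position_def bottom_point_def Int_insert_left insert_Diff_if
        del: mult_Suc_right)
qed

lemma position_empty: "position n {} = (int n + 1, int n + 2)"
  by (simp add: position_def)

lemma empty_filter: "{} \<in> filters"
  by (simp add: snake_filters_iff up_closed_empty)

lemma card_Int_nested:
  assumes "finite A" "finite B" "A \<subseteq> B \<or> B \<subseteq> A"
  shows "card (A \<inter> B) = min (card A) (card B)"
  using assms(3)
proof
  assume "A \<subseteq> B"
  then show ?thesis using card_mono[OF assms(2)] by (simp add: Int_absorb2)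
next
  assume "B \<subseteq> A"
  then show ?thesis using card_mono[OF assms(1)] by (simp add: Int_absorb1)
qed

text \<open>Joins of grid points are intersections of filters because traces on a chain are nested. Two points
  in a row belong to nested filters with the same trace on the second chain, and the filters between
  them fill the gap; columns are dual. A step towards the top removes the largest label.\<close>

lemma staircase_positions: "staircase (position n ` filters) (int n + 1, int n + 2)"
proof
  let ?J = "position n ` filters"
  show "finite ?J" using finite_filters by simp
  show "(int n + 1, int n + 2) \<in> ?J"
    using empty_filter position_empty by (metis imageI)
  show "grid_le p (int n + 1, int n + 2)" if "p \<in> ?J" for p
    using that by (auto simp: grid_le_def position_def)
next
  let ?J = "position n ` filters"
  fix x y x' t assume "(x, y) \<in> ?J" "(x', y) \<in> ?J" and t: "x \<le> t" "t \<le> x'"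
  then obtain U V where U: "U \<in> filters" "position n U = (x, y)"
    and V: "V \<in> filters" "position n V = (x', y)"
    by (metis imageE)
  have "V \<subseteq> U" using position_le_iff[OF U(1) V(1)] U V t by (simp add: grid_le_def)
  have same: "V - first_chain = U - first_chain"
    using U(2) V(2) filtersD(3)[OF U(1)] \<open>V \<subseteq> U\<close>
    by (intro card_subset_eq) (auto simp: position_def)
  \<comment> \<open>the size of a filter at \<open>(t, y)\<close>, given its trace on the second chain\<close>
  let ?k = "nat (int n + 1 - t) + card (U - first_chain)"
  have "card V \<le> ?k" "?k \<le> card U"
    using U(2) V(2) t same card_Int_Diff[of U first_chain] card_Int_Diff[of V first_chain] filtersD(3) U(1) V(1)
    by (auto simp: position_def)
  then obtain W where W: "up_closed w W" "V \<subseteq> W" "W \<subseteq> U" "card W = ?k"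
    using up_closed_between[of w V U] U V filtersD \<open>V \<subseteq> U\<close> by metis
  then have "W \<in> filters"
    using filtersD(1)[OF U(1)] by (auto simp: snake_filters_iff)
  moreover have "W - first_chain = U - first_chain" using W same by blast
  then have "position n W = (t, y)"
    using card_Int_Diff[of W first_chain] filtersD(3)[OF \<open>W \<in> filters\<close>] W(4) U(2) V(2) t
    by (auto simp: position_def)
  ultimately show "(t, y) \<in> ?J" by (metis imageI)
next
  let ?J = "position n ` filters"
  fix x y y' t assume "(x, y) \<in> ?J" "(x, y') \<in> ?J" and t: "y \<le> t" "t \<le> y'"
  then obtain U V where U: "U \<in> filters" "position n U = (x, y)"
    and V: "V \<in> filters" "position n V = (x, y')"
    by (metis imageE)
  have "V \<subseteq> U" using position_le_iff[OF U(1) V(1)] U V t by (simp add: grid_le_def)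
  have same: "V \<inter> first_chain = U \<inter> first_chain"
    using U(2) V(2) filtersD(3)[OF U(1)] \<open>V \<subseteq> U\<close>
    by (intro card_subset_eq) (auto simp: position_def)
  \<comment> \<open>the size of a filter at \<open>(x, t)\<close>, given its trace on the first chain\<close>
  let ?k = "nat (int n + 2 - t) + card (U \<inter> first_chain)"
  have "card V \<le> ?k" "?k \<le> card U"
    using U(2) V(2) t same card_Int_Diff[of U first_chain] card_Int_Diff[of V first_chain] filtersD(3) U(1) V(1)
    by (auto simp: position_def)
  then obtain W where W: "up_closed w W" "V \<subseteq> W" "W \<subseteq> U" "card W = ?k"
    using up_closed_between[of w V U] U V filtersD \<open>V \<subseteq> U\<close> by metis
  then have "W \<in> filters"
    using filtersD(1)[OF U(1)] by (auto simp: snake_filters_iff)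
  moreover have "W \<inter> first_chain = U \<inter> first_chain" using W same by blast
  then have "position n W = (x, t)"
    using card_Int_Diff[of W first_chain] filtersD(3)[OF \<open>W \<in> filters\<close>] W(4) U(2) V(2) t
    by (auto simp: position_def)
  ultimately show "(x, t) \<in> ?J" by (metis imageI)
next
  let ?J = "position n ` filters"
  fix x y x' y' assume "(x, y) \<in> ?J" "(x', y') \<in> ?J"
  then obtain U V where U: "U \<in> filters" "position n U = (x, y)"
    and V: "V \<in> filters" "position n V = (x', y')"
    by (metis imageE)
  have "U \<inter> V \<in> filters"
    using up_closed_Int[OF filtersD(2)[OF U(1)] filtersD(2)[OF V(1)]] filtersD(1)[OF U(1)]
    by (auto simp: snake_filters_iff)
  moreover have "position n (U \<inter> V) = (max x x', max y y')"
  proof -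
    have "card ((U \<inter> first_chain) \<inter> (V \<inter> first_chain))
        = min (card (U \<inter> first_chain)) (card (V \<inter> first_chain))"
      by (rule card_Int_nested) (use filters_nested(1)[OF U(1) V(1)] filtersD(3) U V in auto)
    moreover have "(U \<inter> first_chain) \<inter> (V \<inter> first_chain) = U \<inter> V \<inter> first_chain" by blast
    moreover have "card ((U - first_chain) \<inter> (V - first_chain))
        = min (card (U - first_chain)) (card (V - first_chain))"
      by (rule card_Int_nested) (use filters_nested(2)[OF U(1) V(1)] filtersD(3) U V in auto)
    moreover have "(U - first_chain) \<inter> (V - first_chain) = U \<inter> V - first_chain" by blast
    ultimately show ?thesis
      using U(2) V(2) by (auto simp: position_def min_def max_def)
  qed
  ultimately show "(max x x', max y y') \<in> ?J" by (metis imageI)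
next
  let ?J = "position n ` filters"
  fix x y assume "(x, y) \<in> ?J" and notop: "(x, y) \<noteq> (int n + 1, int n + 2)"
  then obtain U where U: "U \<in> filters" "position n U = (x, y)"
    by (metis imageE)
  with notop position_empty have "U \<noteq> {}" by auto
  let ?a = "Max U"
  have a: "?a \<in> U" using filtersD(3)[OF U(1)] \<open>U \<noteq> {}\<close> by (rule Max_in)
  have "U - {?a} \<in> filters"
    using up_closed_remove_Max[OF up_closed_empty filtersD(2,3)[OF U(1)]] filtersD(1)[OF U(1)]
      \<open>U \<noteq> {}\<close>
    by (auto simp: snake_filters_iff)
  moreover have "position n (U - {?a}) \<in> {(x + 1, y), (x, y + 1)}"
  proof (cases "?a \<in> first_chain")
    case True
    then have "(U - {?a}) \<inter> first_chain = (U \<inter> first_chain) - {?a}"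
      "U - {?a} - first_chain = U - first_chain" by auto
    moreover have "Suc (card (U \<inter> first_chain - {?a})) = card (U \<inter> first_chain)"
      using True a filtersD(3)[OF U(1)] by (intro card_Suc_Diff1) auto
    ultimately show ?thesis
      using U(2) by (simp add: position_def)
  next
    case False
    then have "(U - {?a}) \<inter> first_chain = U \<inter> first_chain"
      "U - {?a} - first_chain = (U - first_chain) - {?a}" by auto
    moreover have "Suc (card (U - first_chain - {?a})) = card (U - first_chain)"
      using False a filtersD(3)[OF U(1)] by (intro card_Suc_Diff1) auto
    ultimately show ?thesis
      using U(2) by (simp add: position_def)
  qed
  ultimately show "(x + 1, y) \<in> ?J \<or> (x, y + 1) \<in> ?J" by (metis imageI insertE singletonD)
qed

end

section \<open>The embedding\<close>

text \<open>When \<open>k\<close> is the last index with \<open>w\<^sub>k \<noteq> w\<^sub>m\<close>, these are the odd labels belonging to the last run of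
  equal letters.\<close>

definition odd_labels :: "nat \<Rightarrow> nat \<Rightarrow> nat set" where
  "odd_labels k m = (\<lambda>j. 2 * j + 1) ` {k<..m}"

text \<open>The member of the pair \<open>2k + 1\<close>, \<open>2k + 2\<close> that continues the chain formed by the odd labels of a
  following run of the letter \<open>l\<close>. For \<open>k \<ge> 1\<close> the letter changes after \<open>k\<close>, so this is the even
  label; for \<open>k = 0\<close> a run of \<open>R\<close> is no change.\<close>

definition turn_label :: "letter \<Rightarrow> nat \<Rightarrow> nat" where
  "turn_label l k = (if k = 0 \<and> l = R then 1 else 2 * k + 2)"

lemma mem_odd_labels: "x \<in> odd_labels k m \<longleftrightarrow> (\<exists>j. k < j \<and> j \<le> m \<and> x = 2 * j + 1)"
  by (auto simp: odd_labels_def)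

lemma odd_labels_Suc:
  assumes "k \<le> m"
  shows "odd_labels k (Suc m) = insert (2 * m + 3) (odd_labels k m)"
proof -
  have "{k<..Suc m} = insert (Suc m) {k<..m}" using assms by auto
  then show ?thesis by (simp add: odd_labels_def eval_nat_numeral)
qed

lemma odd_labels_self: "odd_labels k k = {}"
  by (simp add: odd_labels_def)

lemma card_odd_labels: "card (odd_labels k m) = m - k"
  unfolding odd_labels_def by (subst card_image) (auto simp: inj_on_def)

lemma odd_labels_bounds: "x \<in> odd_labels k m \<Longrightarrow> 2 * k + 3 \<le> x \<and> x \<le> 2 * m + 1"
  by (auto simp: odd_labels_def)

lemma even_notin_odd_labels: "2 * j \<notin> odd_labels k m"
  unfolding mem_odd_labels by presburger

lemma turn_label_le: "turn_label l k \<le> 2 * k + 2"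
  by (simp add: turn_label_def)

lemma turn_label_notin: "turn_label l k \<notin> odd_labels k m"
  using odd_labels_bounds[of "turn_label l k" k m] turn_label_le[of l k] by linarith

text \<open>For such \<open>k\<close> and for \<open>l = w\<^sub>m\<close> this is the filter generated by \<open>2m + 2\<close>, described by what it misses.\<close>

definition even_filter :: "letter \<Rightarrow> nat \<Rightarrow> nat \<Rightarrow> nat set" where
  "even_filter l k m = {..2 * m + 2} - insert (turn_label l k) (odd_labels k m)"

lemma even_filter_Suc:
  assumes "k \<le> m"
  shows "even_filter l k (Suc m) =
    insert (2 * m + 4) ({..2 * m + 2} - insert (turn_label l k) (odd_labels k m))"
proof -
  have "2 * m + 4 \<notin> odd_labels k m" "2 * m + 4 \<noteq> turn_label l k"
    using odd_labels_bounds[of "2 * m + 4" k m] turn_label_le[of l k] assms by auto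
  moreover have "{..2 * Suc m + 2} = insert (2 * m + 4) (insert (2 * m + 3) {..2 * m + 2})"
    by auto
  ultimately show ?thesis
    unfolding even_filter_def odd_labels_Suc[OF assms] by auto
qed

context snake
begin

text \<open>Along the run \<open>2m + 2\<close> is covered by \<open>2m\<close>, so each step of the induction adds \<open>2m + 2\<close> and misses the
  new odd label. The run starts with \<open>2k + 4\<close>, which is covered by \<open>2k + 1\<close>, or by \<open>2\<close> when \<open>k = 0\<close> and
  the letter is \<open>R\<close>.\<close>

lemma even_filter_least:
  assumes "k < m" "m \<le> n" "\<And>j. k < j \<Longrightarrow> j \<le> m \<Longrightarrow> w ! j = l" "w ! k \<noteq> l"
  shows "up_closed w (even_filter l k m)"
    and "\<And>V. up_closed w V \<Longrightarrow> 2 * m + 2 \<in> V \<Longrightarrow> even_filter l k m \<subseteq> V"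
proof -
  have "up_closed w (even_filter l k m) \<and>
      (\<forall>V. up_closed w V \<longrightarrow> 2 * m + 2 \<in> V \<longrightarrow> even_filter l k m \<subseteq> V)"
    using assms
  proof (induction m)
    case (Suc m)
    have letter: "w ! Suc m = l" using Suc.prems by blast
    have cover: "upper_covers w (2 * m + 4) = {even_cover w (Suc m)}" by simp
    have num: "2 * Suc m + 2 = 2 * m + 4" by simp
    have up: "even_cover w (Suc m) \<in> V" if "up_closed w V" "2 * Suc m + 2 \<in> V" for V
      using up_closedD[OF that(1), of "2 * m + 4"] that(2) cover unfolding num by blast
    show ?case
    proof (cases "k = m")
      case True
      show ?thesis
      proof (cases "k = 0 \<and> l = R")
        case special: True
        have "even_cover w (Suc m) = 2"
          using special True letter by (simp add: even_cover_def)
        have "m = 0" "turn_label l k = 1" using special True by (simp_all add: turn_label_def)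
        have "{..2 * m + 2} - {1} = {2, 0}" unfolding \<open>m = 0\<close> by auto
        then have "even_filter l k (Suc m) = insert (2 * m + 4) {2, 0}"
          using even_filter_Suc[of k m l] \<open>turn_label l k = 1\<close> True odd_labels_self[of m]
          by (simp only: le_refl)
        moreover have "up_closed w (insert (2 * m + 4) {2, 0})"
          using \<open>even_cover w (Suc m) = 2\<close>
          by (intro up_closed_insert up_closed_empty) simp_all
        moreover have "insert (2 * m + 4) {2, 0} \<subseteq> V"
          if "up_closed w V" "2 * Suc m + 2 \<in> V" for V
        proof -
          have "2 \<in> V" using up[OF that] \<open>even_cover w (Suc m) = 2\<close> by simp
          moreover from this have "0 \<in> V" using up_closedD[OF that(1)] by simp
          ultimately show ?thesis using that(2)[unfolded num] by simp
        qed
        ultimately show ?thesis by (simp only:) blast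
      next
        case False
        have c: "even_cover w (Suc m) = 2 * m + 1"
          using False True letter Suc.prems(4) by (auto simp: even_cover_def)
        have "turn_label l k = 2 * m + 2" using False True by (auto simp: turn_label_def)
        moreover have "{..2 * m + 2} - {2 * m + 2} = {..2 * m + 1}" by auto
        ultimately have "even_filter l k (Suc m) = insert (2 * m + 4) {..2 * m + 1}"
          using even_filter_Suc[of k m l] True odd_labels_self[of m]
          by (simp only: le_refl)
        moreover have "up_closed w (insert (2 * m + 4) {..2 * m + 1})"
          using c by (intro up_closed_insert up_closed_atMost) simp
        moreover have "insert (2 * m + 4) {..2 * m + 1} \<subseteq> V"
          if "up_closed w V" "2 * Suc m + 2 \<in> V" for V
          using up_closed_odd[OF that(1), of m] up[OF that] that(2)[unfolded num] c by simp
        ultimately show ?thesis by (simp only:) blast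
      qed
    next
      case False
      with Suc.prems have "k < m" by simp
      then have "w ! m = l" using Suc.prems by simp
      with letter have c: "even_cover w (Suc m) = 2 * m + 2" by (simp add: even_cover_def)
      have IH: "up_closed w (even_filter l k m)"
        "\<And>V. up_closed w V \<Longrightarrow> 2 * m + 2 \<in> V \<Longrightarrow> even_filter l k m \<subseteq> V"
        using Suc.IH \<open>k < m\<close> Suc.prems by simp_all
      have step: "even_filter l k (Suc m) = insert (2 * m + 4) (even_filter l k m)"
        using even_filter_Suc[of k m l] \<open>k < m\<close> by (simp add: even_filter_def)
      have "2 * m + 2 \<in> even_filter l k m"
        using turn_label_le[of l k] \<open>k < m\<close> even_notin_odd_labels[of "Suc m" k m]
        by (simp add: even_filter_def)
      then have "up_closed w (even_filter l k (Suc m))"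
        unfolding step using IH(1) c by (intro up_closed_insert) simp_all
      moreover have "even_filter l k (Suc m) \<subseteq> V"
        if "up_closed w V" "2 * Suc m + 2 \<in> V" for V
        unfolding step using IH(2)[OF that(1)] up[OF that] c that(2)[unfolded num] by simp
      ultimately show ?thesis by blast
    qed
  qed simp
  then show "up_closed w (even_filter l k m)"
    and "\<And>V. up_closed w V \<Longrightarrow> 2 * m + 2 \<in> V \<Longrightarrow> even_filter l k m \<subseteq> V"
    by blast+
qed

lemma last_diff_run:
  assumes "1 \<le> m" "m \<le> n"
  shows "last_diff w m < m" "w ! last_diff w m \<noteq> w ! m"
    and "\<And>j. last_diff w m < j \<Longrightarrow> j \<le> m \<Longrightarrow> w ! j = w ! m"
proof -
  let ?D = "{k. k < m \<and> w ! k \<noteq> w ! m}"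
  have "finite ?D" by simp
  have "0 \<in> ?D" using assms letters[of m] first_letter by auto
  then have "Max ?D \<in> ?D" by (intro Max_in[OF \<open>finite ?D\<close>]) blast
  then show "last_diff w m < m" "w ! last_diff w m \<noteq> w ! m"
    by (simp_all add: last_diff_def)
  fix j assume j: "last_diff w m < j" "j \<le> m"
  show "w ! j = w ! m"
  proof (rule ccontr)
    assume "w ! j \<noteq> w ! m"
    with j have "j \<in> ?D" by (auto simp: le_less)
    with Max_ge[OF \<open>finite ?D\<close>] j(1) show False by (fastforce simp: last_diff_def)
  qed
qed

lemma filter_gen_bottom:
  assumes "m \<le> n"
  shows "filter_gen w m {2 * m + 3} = {..2 * m + 3}"
  using up_closed_odd[of w _ "Suc m"]
  by (intro filter_gen_eqI[OF assms]) (simp_all add: up_closed_atMost eval_nat_numeral)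

text \<open>If all missing elements lie in one chain, the other coordinate is \<open>0\<close>.\<close>

lemma position_diff:
  assumes "m \<le> n" "D \<subseteq> {..2 * m + 2}" "\<And>x. x \<in> D \<Longrightarrow> x \<in> first_chain \<longleftrightarrow> l = R"
  shows "position m ({..2 * m + 2} - D) = axis_point l (int (card D))"
proof -
  have fin: "finite D" using assms(2) finite_subset by blast
  have c: "card ({..2 * m + 2} \<inter> first_chain) = m + 1" "card ({..2 * m + 2} - first_chain) = m + 2"
    using card_first_chain[of "Suc m"] by simp_all
  show ?thesis
  proof (cases "l = R")
    case True
    then have D: "D \<subseteq> {..2 * m + 2} \<inter> first_chain" using assms by auto
    then have "({..2 * m + 2} - D) \<inter> first_chain = {..2 * m + 2} \<inter> first_chain - D"
      "{..2 * m + 2} - D - first_chain = {..2 * m + 2} - first_chain" by auto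
    moreover have "card D \<le> m + 1" using card_mono[OF _ D] c by simp
    ultimately show ?thesis
      using True c card_Diff_subset[OF fin D]
      by (simp add: position_def axis_point_def)
  next
    case False
    then have D: "D \<subseteq> {..2 * m + 2} - first_chain" using assms by auto
    then have "({..2 * m + 2} - D) \<inter> first_chain = {..2 * m + 2} \<inter> first_chain"
      "{..2 * m + 2} - D - first_chain = {..2 * m + 2} - first_chain - D" by auto
    moreover have "card D \<le> m + 2" using card_mono[OF _ D] c by simp
    ultimately show ?thesis
      using False c card_Diff_subset[OF fin D]
      by (simp add: position_def axis_point_def)
  qed
qed

context
  fixes m k :: nat and l :: letter
  assumes m: "1 \<le> m" "m \<le> n" and k_def: "k = last_diff w m" and l_def: "l = w ! m"
begin

lemma run: "k < m" "w ! k \<noteq> l" "k < j \<Longrightarrow> j \<le> m \<Longrightarrow> w ! j = l"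
  using last_diff_run[OF m] unfolding k_def l_def by blast+

lemma even_filter_facts:
  "up_closed w (even_filter l k m)"
  "up_closed w V \<Longrightarrow> 2 * m + 2 \<in> V \<Longrightarrow> even_filter l k m \<subseteq> V"
  using even_filter_least[of k m l] run m by blast+

lemma last_in_even_filter: "2 * m + 2 \<in> even_filter l k m"
  using turn_label_le[of l k] run(1) even_notin_odd_labels[of "Suc m" k m]
  by (simp add: even_filter_def)

lemma filter_gen_even: "filter_gen w m {2 * m + 2} = even_filter l k m"
  using even_filter_facts last_in_even_filter
  by (intro filter_gen_eqI[OF m(2)]) (auto simp: even_filter_def)

lemma segment_turn:
  "{..2 * m + 2} - odd_labels k m = even_filter l k m \<union> {..turn_label l k}"
  using turn_label_le[of l k] run(1) odd_labels_bounds[of _ k m]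
  by (fastforce simp: even_filter_def)

lemma segment_odd:
  assumes "k < j" "j \<le> m"
  shows "{..2 * m + 2} - odd_labels j m = even_filter l k m \<union> {..2 * j + 1}"
proof -
  have "x \<in> odd_labels k m \<longleftrightarrow> x \<le> 2 * j + 1 \<and> x \<in> odd_labels k m \<or> x \<in> odd_labels j m" for x
    using assms by (auto simp: mem_odd_labels)
  then show ?thesis
    using turn_label_le[of l k] assms odd_labels_bounds[of _ j m]
    by (fastforce simp: even_filter_def)
qed

lemma up_closed_segment:
  assumes "k \<le> j" "j \<le> m"
  shows "up_closed w ({..2 * m + 2} - odd_labels j m)"
proof (cases "j = k")
  case True
  then show ?thesis
    by (simp only: segment_turn up_closed_Un even_filter_facts up_closed_atMost)
next
  case False
  with assms have "k < j" by simp
  then show ?thesis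
    using assms(2) by (simp only: segment_odd up_closed_Un even_filter_facts up_closed_atMost)
qed

lemma filter_gen_turn:
  "filter_gen w m {2 * m + 2, turn_label l k} = {..2 * m + 2} - odd_labels k m"
proof (rule filter_gen_eqI[OF m(2)])
  show "up_closed w ({..2 * m + 2} - odd_labels k m)"
    using run(1) by (intro up_closed_segment) simp_all
  show "{2 * m + 2, turn_label l k} \<subseteq> {..2 * m + 2} - odd_labels k m"
    unfolding segment_turn using last_in_even_filter by simp
  show "{..2 * m + 2} - odd_labels k m \<subseteq> V"
    if "up_closed w V" "{2 * m + 2, turn_label l k} \<subseteq> V" for V
    using even_filter_facts(2)[OF that(1)] that(2) by (auto simp: even_filter_def)
qed auto

lemma filter_gen_odd:
  assumes j: "k < j" "j \<le> m"
  shows "filter_gen w m {2 * m + 2, 2 * j + 1} = {..2 * m + 2} - odd_labels j m"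
proof (rule filter_gen_eqI[OF m(2)])
  show "up_closed w ({..2 * m + 2} - odd_labels j m)"
    using j by (intro up_closed_segment) simp_all
  show "{2 * m + 2, 2 * j + 1} \<subseteq> {..2 * m + 2} - odd_labels j m"
    unfolding segment_odd[OF j] using last_in_even_filter by simp
  show "{..2 * m + 2} - odd_labels j m \<subseteq> V"
    if "up_closed w V" "{2 * m + 2, 2 * j + 1} \<subseteq> V" for V
    unfolding segment_odd[OF j]
    using even_filter_facts(2)[OF that(1)] up_closed_odd[OF that(1), of j] that(2) by simp
qed auto

text \<open>A closed set containing \<open>2j + 1\<close> contains all smaller labels, so the filter is determined by the
  largest odd label of the run that belongs to it, or, if there is none, by whether the turn label
  belongs to it.\<close>

lemma new_filters:
  assumes U: "up_closed w U" "U \<subseteq> {..2 * m + 2}" "2 * m + 2 \<in> U"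
  shows "U = even_filter l k m \<or> (\<exists>j. k \<le> j \<and> j \<le> m \<and> U = {..2 * m + 2} - odd_labels j m)"
proof -
  have sub: "even_filter l k m \<subseteq> U" using even_filter_facts(2) U by blast
  let ?J = "{j. k < j \<and> j \<le> m \<and> 2 * j + 1 \<in> U}"
  show ?thesis
  proof (cases "?J = {}")
    case True
    then have "U \<inter> odd_labels k m = {}" by (auto simp: mem_odd_labels)
    with sub U(2) have "U = even_filter l k m \<or> U = {..2 * m + 2} - odd_labels k m"
      by (auto simp: even_filter_def)
    then show ?thesis using run(1) by auto
  next
    case False
    have "finite ?J" by simp
    obtain j where j: "j \<in> ?J" and greatest: "\<And>i. i \<in> ?J \<Longrightarrow> i \<le> j"
      by (rule that[OF Max_in[OF \<open>finite ?J\<close> False] Max_ge[OF \<open>finite ?J\<close>]])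
    have "U \<inter> odd_labels j m = {}"
    proof (rule equals0I)
      fix x assume "x \<in> U \<inter> odd_labels j m"
      then obtain i where "j < i" "i \<le> m" "2 * i + 1 \<in> U" by (auto simp: mem_odd_labels)
      with greatest[of i] j show False by auto
    qed
    moreover have "x \<in> U" if "x \<le> 2 * m + 2" "x \<notin> odd_labels j m" for x
    proof (cases "x \<le> 2 * j + 1")
      case True
      with up_closed_odd[OF U(1), of j] j show ?thesis by auto
    next
      case False
      then have "x \<in> even_filter l k m"
        using that j turn_label_le[of l k] by (auto simp: even_filter_def mem_odd_labels)
      with sub show ?thesis by blast
    qed
    ultimately have "U = {..2 * m + 2} - odd_labels j m" using U(2) by auto
    moreover have "k \<le> j" "j \<le> m" using j by simp_all
    ultimately show ?thesis by blast
  qed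
qed

lemma odd_labels_chain: "k \<le> j \<Longrightarrow> x \<in> odd_labels j m \<Longrightarrow> x \<in> first_chain \<longleftrightarrow> l = R"
  using first_chain_simps(2) run(3) m(2) by (auto simp: mem_odd_labels)

lemma turn_label_chain: "turn_label l k \<in> first_chain \<longleftrightarrow> l = R"
proof (cases "k = 0")
  case True
  then show ?thesis
    using first_chain_simps(2,3)[of 0] by (auto simp: turn_label_def numeral_2_eq_2)
next
  case False
  show ?thesis
  proof -
    have "w ! k = L \<or> w ! k = R" "l = L \<or> l = R"
      using False letters[of k] letters[of m] run(1) m unfolding l_def by linarith+
    then have "w ! k = R \<longleftrightarrow> l \<noteq> R" using run(2) by auto
    then show ?thesis
      using first_chain_simps(3)[of k] False run(1) m(2) by (simp add: turn_label_def)
  qed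
qed

lemma position_even_filter: "position m (even_filter l k m) = axis_point l (int m - int k + 1)"
proof -
  have "position m (even_filter l k m)
      = axis_point l (int (card (insert (turn_label l k) (odd_labels k m))))"
    unfolding even_filter_def
  proof (rule position_diff[OF m(2)])
    show "insert (turn_label l k) (odd_labels k m) \<subseteq> {..2 * m + 2}"
      using turn_label_le[of l k] run(1) by (auto dest!: odd_labels_bounds)
    show "x \<in> first_chain \<longleftrightarrow> l = R" if "x \<in> insert (turn_label l k) (odd_labels k m)" for x
      using that turn_label_chain odd_labels_chain[OF order_refl] by blast
  qed
  also have "card (insert (turn_label l k) (odd_labels k m)) = m - k + 1"
    using turn_label_notin[of l k m] card_odd_labels[of k m] by (simp add: odd_labels_def)
  finally show ?thesis using run(1) by (simp add: algebra_simps)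
qed

lemma position_segment:
  assumes "k \<le> j" "j \<le> m"
  shows "position m ({..2 * m + 2} - odd_labels j m) = axis_point l (int m - int j)"
proof -
  have "odd_labels j m \<subseteq> {..2 * m + 2}" by (auto dest!: odd_labels_bounds)
  from position_diff[OF m(2) this odd_labels_chain[OF assms(1)]] show ?thesis
    using card_odd_labels[of j m] assms(2) by simp
qed

lemma filters_step:
  "snake_filters w m = snake_filters w (m - 1)
    \<union> {even_filter l k m, {..2 * m + 2} - odd_labels k m}
    \<union> {{..2 * m + 2} - odd_labels (k + i) m | i. 1 \<le> i \<and> i \<le> m - k}
    \<union> {{..2 * m + 3}}" (is "_ = ?old \<union> ?G \<union> ?S \<union> ?B")
proof (intro equalityI subsetI)
  fix U assume "U \<in> snake_filters w m"
  then have U: "up_closed w U" "U \<subseteq> {..2 * m + 3}" using snake_filters_iff m by auto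
  consider "2 * m + 3 \<in> U" | "2 * m + 3 \<notin> U" "2 * m + 2 \<in> U" | "2 * m + 3 \<notin> U" "2 * m + 2 \<notin> U"
    by blast
  then show "U \<in> ?old \<union> ?G \<union> ?S \<union> ?B"
  proof cases
    case 1
    with up_closed_odd[OF U(1), of "Suc m"] U(2) show ?thesis
      by (auto simp: eval_nat_numeral)
  next
    case 2
    have "x \<le> 2 * m + 2" if "x \<in> U" for x
    proof -
      have "x \<le> 2 * m + 3" "x \<noteq> 2 * m + 3" using U(2) 2(1) that by auto
      then show ?thesis by linarith
    qed
    then have "U \<subseteq> {..2 * m + 2}" by auto
    from new_filters[OF U(1) this 2(2)] show ?thesis
    proof (elim disjE exE conjE)
      fix j assume j: "k \<le> j" "j \<le> m" "U = {..2 * m + 2} - odd_labels j m"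
      show ?thesis
      proof (cases "j = k")
        case False
        then have "U = {..2 * m + 2} - odd_labels (k + (j - k)) m \<and> 1 \<le> j - k \<and> j - k \<le> m - k"
          using j by auto
        then show ?thesis by blast
      qed (use j in simp)
    qed simp
  next
    case 3
    have "x \<le> 2 * (m - 1) + 3" if "x \<in> U" for x
    proof -
      have "x \<le> 2 * m + 3" "x \<noteq> 2 * m + 3" "x \<noteq> 2 * m + 2" using U(2) 3 that by auto
      then show ?thesis by linarith
    qed
    with U(1) m have "U \<in> ?old" by (subst snake_filters_iff) auto
    then show ?thesis by blast
  qed
next
  have old: "U \<in> snake_filters w m" if "U \<in> ?old" for U
    using that m snake_filters_iff[of "m - 1" U] snake_filters_iff[of m U] by fastforce
  have seg: "{..2 * m + 2} - odd_labels j m \<in> snake_filters w m" if "k \<le> j" "j \<le> m" for j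
    using up_closed_segment[OF that] m(2) by (subst snake_filters_iff) auto
  have new: "even_filter l k m \<in> snake_filters w m" "{..2 * m + 3} \<in> snake_filters w m"
    using even_filter_facts(1) up_closed_atMost m(2)
    by (subst snake_filters_iff; auto simp: even_filter_def)+
  fix U assume "U \<in> ?old \<union> ?G \<union> ?S \<union> ?B"
  then consider "U \<in> ?old" | "U = even_filter l k m" | "U = {..2 * m + 2} - odd_labels k m"
    | i where "U = {..2 * m + 2} - odd_labels (k + i) m" "i \<le> m - k" | "U = {..2 * m + 3}"
    by blast
  then show "U \<in> snake_filters w m"
  proof cases
    case (4 i)
    then show ?thesis using run(1) seg[of "k + i"] by simp
  qed (use old new seg[of k] run(1) in simp_all)
qed

end

lemma emb_graph_0: "emb_graph w n 0 = (\<lambda>U. (U, position 0 U)) ` snake_filters w 0"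
proof -
  have covers: "upper_covers w 3 = {1, 2}" by (auto simp: upper_covers_def)
  have closed: "up_closed w {0}" "up_closed w {1, 0}" "up_closed w {2, 0}"
    "up_closed w {1, 2, 0}" "up_closed w {3, 1, 2, 0}"
    by (intro up_closed_insert up_closed_empty; simp add: covers)+
  have least: "0 \<in> V" if "up_closed w V" "1 \<in> V \<or> 2 \<in> V" for V
    using that up_closedD[OF that(1), of 1 0] up_closedD[OF that(1), of 2 0] by auto
  have least3: "1 \<in> V" "2 \<in> V" if "up_closed w V" "3 \<in> V" for V
    using up_closedD[OF that] covers by auto
  have gen: "filter_gen w 0 {0} = {0}" "filter_gen w 0 {1} = {1, 0}"
    "filter_gen w 0 {2} = {2, 0}" "filter_gen w 0 {1, 2} = {1, 2, 0}"
    "filter_gen w 0 {3} = {3, 1, 2, 0}"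
    by (rule filter_gen_eqI; use closed least least3 in \<open>simp; blast\<close>)+
  have all: "snake_filters w 0 = {{}, {0}, {1, 0}, {2, 0}, {1, 2, 0}, {3, 1, 2, 0}}"
    (is "_ = ?F")
  proof (intro equalityI subsetI)
    fix U assume "U \<in> snake_filters w 0"
    then have U: "U \<subseteq> {..3}" "up_closed w U" using snake_filters_iff[of 0 U] by auto
    have "{..3} = {3, 1, 2, 0 :: nat}" by auto
    with U(1) have "U \<subseteq> {3, 1, 2, 0}" by simp
    then show "U \<in> ?F" using least[OF U(2)] least3[OF U(2)] by blast
  next
    fix U assume "U \<in> ?F"
    then show "U \<in> snake_filters w 0"
      using closed up_closed_empty by (subst snake_filters_iff) auto
  qed
  have fc: "0 \<notin> first_chain" "1 \<in> first_chain" "2 \<notin> first_chain"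
    "3 \<in> first_chain \<longleftrightarrow> n = 0 \<or> w ! 1 = R"
    using first_chain_simps(1) first_chain_simps(2,3)[of 0] first_chain_simps(2)[of 1]
    by (auto simp: numeral_2_eq_2 numeral_3_eq_3)
  show ?thesis
    unfolding all emb_graph.simps gen
    using fc by (auto simp: position_def bottom_point_def Int_insert_left insert_Diff_if)
qed

text \<open>The recursion places the filters of \<open>filters_step\<close> where counting missing elements puts them.\<close>

lemma emb_graph_eq:
  "m \<le> n \<Longrightarrow> emb_graph w n m = (\<lambda>U. (U, position m U)) ` snake_filters w m"
proof (induction m)
  case 0
  show ?case by (rule emb_graph_0)
next
  case (Suc m')
  define m where "m = Suc m'"
  define k where "k = last_diff w m"
  define l where "l = w ! m"
  have m: "1 \<le> m" "m \<le> n" using Suc.prems by (simp_all add: m_def)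
  note rules = m k_def l_def
  let ?g = "\<lambda>U. (U, position m U)"
  have shift: "{(U, (x + 1, y + 1)) | U x y. (U, (x, y)) \<in> emb_graph w n m'}
      = ?g ` snake_filters w (m - 1)"
    using Suc.IH Suc.prems by (auto simp: position_def m_def image_iff)
  have top: "(filter_gen w m {2 * m + 2}, axis_point l (int m - int k + 1))
      = ?g (even_filter l k m)"
    by (simp only: filter_gen_even[OF rules] position_even_filter[OF rules])
  have turn: "(filter_gen w m {2 * m + 2, turn_label l k}, axis_point l (int m - int k))
      = ?g ({..2 * m + 2} - odd_labels k m)"
    using run(1)[OF rules] by (simp only: filter_gen_turn[OF rules] position_segment[OF rules]
        order_refl less_imp_le)
  have segment: "(filter_gen w m {2 * m + 2, 2 * k + 2 * i + 1}, axis_point l (int m - int k - int i))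
      = ?g ({..2 * m + 2} - odd_labels (k + i) m)" if "1 \<le> i" "i \<le> m - k" for i
    using that filter_gen_odd[OF rules, of "k + i"] position_segment[OF rules, of "k + i"]
    by (simp add: algebra_simps)
  have odd: "{(filter_gen w m {2 * m + 2, 2 * k + 2 * i + 1},
        axis_point l (int m - int k - int i)) | i. 1 \<le> i \<and> i \<le> m - k}
      = ?g ` {{..2 * m + 2} - odd_labels (k + i) m | i. 1 \<le> i \<and> i \<le> m - k}"
    unfolding setcompr_eq_image image_image
    by (intro image_cong refl segment) simp_all
  have bottom: "(filter_gen w m {2 * m + 3}, bottom_point w n m) = ?g {..2 * m + 3}"
    using m by (simp add: filter_gen_bottom position_full)
  have "emb_graph w n m = {(U, (x + 1, y + 1)) | U x y. (U, (x, y)) \<in> emb_graph w n m'}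
     \<union> {(filter_gen w m {2 * m + 2}, axis_point l (int m - int k + 1)),
        (filter_gen w m {2 * m + 2, turn_label l k}, axis_point l (int m - int k))}
     \<union> {(filter_gen w m {2 * m + 2, 2 * k + 2 * i + 1}, axis_point l (int m - int k - int i)) | i.
          1 \<le> i \<and> i \<le> m - k}
     \<union> {(filter_gen w m {2 * m + 3}, bottom_point w n m)}"
    unfolding k_def l_def turn_label_def unfolding m_def
    by (simp only: emb_graph.simps(2) Let_def)
  also have "\<dots> = ?g ` snake_filters w m"
    unfolding filters_step[OF rules] shift top turn odd bottom
    by (simp only: image_Un image_insert image_empty)
  finally show ?case by (simp only: m_def)
qed

lemma emb_eq_position: "U \<in> filters \<Longrightarrow> emb w n U = position n U"
  unfolding emb_def emb_graph_eq[OF le_refl] by (rule the_equality) auto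

lemma snake_grid_eq: "snake_grid w n = position n ` filters"
  unfolding snake_grid_def by (rule image_cong[OF refl emb_eq_position])

lemma chain_poly_filters:
  "chain_poly filter_le filters
    = path_weight_sum (snake_grid w n) (-1, 0) (int n + 1, int n + 2) * [:1, 1:]"
proof -
  interpret staircase "snake_grid w n" "(int n + 1, int n + 2)"
    unfolding snake_grid_eq by (rule staircase_positions)
  have full: "{..2 * n + 3} \<in> filters" by (simp add: snake_filters_iff up_closed_atMost)
  have bottom: "position n {..2 * n + 3} = (-1, 0)"
    by (simp add: position_full bottom_point_def)
  have "grid_le (-1, 0) (position n U)" if "U \<in> filters" for U
    using position_le_iff[OF full that] filtersD(1)[OF that] bottom by simp
  then have "above (-1, 0) = snake_grid w n"
    unfolding above_def unfolding snake_grid_eq by auto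
  moreover have "(-1, 0) \<in> snake_grid w n"
    unfolding snake_grid_eq using full bottom by (metis imageI)
  moreover have "chain_poly grid_le (position n ` filters) = chain_poly filter_le filters"
    using finite_filters inj_position
    by (rule chain_poly_image) (simp add: position_le_iff filter_le_def)
  ultimately show ?thesis using chain_poly_above[of "(-1, 0)"] by (simp only: snake_grid_eq)
qed

lemma chain_poly_filters_from_top:
  "chain_poly filter_le (filters_from w n (int n + 1) (int n + 2)) = [:1, 1:]"
proof -
  have "U = {}" if "U \<in> filters" "grid_le (int n + 1, int n + 2) (position n U)" for U
    using position_le_iff[OF empty_filter that(1)] that(2) position_empty by simp
  then have "U = {}" if "U \<in> filters_from w n (int n + 1) (int n + 2)" for U
    using that emb_eq_position[of U] by (auto simp: filters_from_def grid_le_def)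
  moreover have "{} \<in> filters_from w n (int n + 1) (int n + 2)"
    using empty_filter position_empty by (simp add: filters_from_def emb_eq_position)
  ultimately have "filters_from w n (int n + 1) (int n + 2) = insert {} {}" by blast
  moreover have "chain_poly filter_le (insert {} {}) = [:1, 1:] * chain_poly filter_le {}"
    by (rule chain_poly_insert_comparable) (auto simp: filter_le_def)
  ultimately show ?thesis by (simp add: chain_poly_empty)
qed

end

section \<open>Mirror words and the chain polynomial\<close>

text \<open>The mirror image of a word only changes which of \<open>1\<close> and \<open>2\<close> covers \<open>4\<close>: all later covers depend on
  whether neighbouring letters agree, and this is invariant.\<close>

definition swap_labels :: "nat \<Rightarrow> nat" where
  "swap_labels = id(1 := 2, 2 := 1)"

lemma swap_labels_involution: "swap_labels (swap_labels x) = x"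
  by (simp add: swap_labels_def)

lemma swap_labels_le: "3 \<le> t \<Longrightarrow> swap_labels x \<le> t \<longleftrightarrow> x \<le> t"
  by (auto simp: swap_labels_def)

lemma mirror_word_nth: "snake_word n w \<Longrightarrow> j \<le> n \<Longrightarrow> mirror_word w ! j = swap_letter (w ! j)"
  by (simp add: mirror_word_def snake_word_def)

lemma swap_letter_involution: "swap_letter (swap_letter l) = l"
  by (cases l) simp_all

lemma mirror_mirror: "mirror_word (mirror_word w) = w"
  by (simp add: mirror_word_def swap_letter_involution o_def)

lemma snake_word_mirror: "snake_word n w \<Longrightarrow> snake_word n (mirror_word w)"
  using mirror_word_nth[of n w] by (auto simp: snake_word_def mirror_word_def)

lemma even_cover_mirror:
  assumes "snake_word n w" "Suc m \<le> n"
  shows "even_cover (mirror_word w) (Suc m) = swap_labels (even_cover w (Suc m))"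
proof -
  interpret snake n w using assms(1) by unfold_locales
  have nth: "mirror_word w ! Suc m = swap_letter (w ! Suc m)" "mirror_word w ! m = swap_letter (w ! m)"
    using mirror_word_nth[OF assms(1)] assms(2) by simp_all
  have "w ! Suc m = L \<or> w ! Suc m = R" using letters assms(2) by simp
  moreover have "m = 0 \<and> w ! m = Eps \<or> 1 \<le> m \<and> (w ! m = L \<or> w ! m = R)"
    using letters[of m] first_letter assms(2) by (cases m) simp_all
  ultimately show ?thesis
    using nth by (elim disjE conjE) (simp_all add: even_cover_def swap_labels_def)
qed

lemma up_closed_mirror:
  assumes "snake_word n w" "U \<subseteq> {..2 * n + 3}" "up_closed w U"
  shows "up_closed (mirror_word w) (swap_labels ` U)"
proof -
  have "upper_covers (mirror_word w) (swap_labels x) \<subseteq> swap_labels ` upper_covers w x"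
    if "x \<le> 2 * n + 3" for x
  proof (cases x rule: nat_snake_cases)
    case (4 m)
    then have "swap_labels x = 2 * m + 3" by (simp add: swap_labels_def)
    then show ?thesis unfolding 4 upper_covers_simps by (auto simp: swap_labels_def)
  next
    case (5 m)
    then show ?thesis
      using even_cover_mirror[OF assms(1), of m] that by (simp add: swap_labels_def)
  qed (auto simp: swap_labels_def)
  then show ?thesis
    using assms(2,3) unfolding up_closed_def by blast
qed

lemma mirror_filters_subset:
  assumes "snake_word n w"
  shows "image swap_labels ` snake_filters w n \<subseteq> snake_filters (mirror_word w) n"
proof -
  interpret snake n w using assms by unfold_locales
  interpret mirror: snake n "mirror_word w"
    using snake_word_mirror[OF assms] by unfold_locales
  show ?thesis
  proof (intro subsetI, elim imageE)
    fix U V assume "U = swap_labels ` V" "V \<in> snake_filters w n"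
    then show "U \<in> snake_filters (mirror_word w) n"
      using up_closed_mirror[OF assms, of V] filtersD[of V] swap_labels_le[of "2 * n + 3"]
      by (auto simp: mirror.snake_filters_iff)
  qed
qed

lemma chain_poly_mirror:
  assumes "snake_word n w"
  shows "chain_poly filter_le (snake_filters (mirror_word w) n)
    = chain_poly filter_le (snake_filters w n)"
proof -
  interpret snake n w using assms by unfold_locales
  have invol: "swap_labels ` (swap_labels ` U) = U" for U
    by (simp add: image_image swap_labels_involution)
  have inj: "inj swap_labels" by (metis injI swap_labels_involution)
  have "snake_filters (mirror_word w) n \<subseteq> image swap_labels ` filters"
  proof
    fix U assume "U \<in> snake_filters (mirror_word w) n"
    then have "swap_labels ` U \<in> filters"
      using mirror_filters_subset[OF snake_word_mirror[OF assms]] by (auto simp: mirror_mirror)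
    then show "U \<in> image swap_labels ` filters" using invol by (metis imageI)
  qed
  with mirror_filters_subset[OF assms]
  have "snake_filters (mirror_word w) n = image swap_labels ` filters" by blast
  moreover have "chain_poly filter_le (image swap_labels ` filters) = chain_poly filter_le filters"
  proof (rule chain_poly_image)
    show "inj_on (image swap_labels) filters" by (metis inj_onI invol)
    show "filter_le (swap_labels ` U) (swap_labels ` V) \<longleftrightarrow> filter_le U V" for U V
      by (simp add: filter_le_def inj_image_subset_iff[OF inj])
  qed (rule finite_filters)
  ultimately show ?thesis by simp
qed

text \<open>Since \<open>{}\<close> is the only filter at the top point, the factor \<open>C\<^sub>n\<^sub>+\<^sub>1\<^sub>,\<^sub>n\<^sub>+\<^sub>2\<close> is \<open>1 + z\<close>, which can be cancelled
  in the integral domain of integer polynomials.\<close>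

theorem theorem3p3:
  fixes n :: nat and w :: "letter list"
  assumes "snake_word n w"
    and "n \<ge> 1 \<Longrightarrow> w ! n = R"
  shows "(\<forall>A. chain_poly filter_le (snake_filters w n)
               = A * chain_poly filter_le (filters_from w n (int n + 1) (int n + 2))
             \<longleftrightarrow> A = path_weight_sum (snake_grid w n) (-1, 0) (int n + 1, int n + 2))
    \<and> chain_poly filter_le (snake_filters w n)
        = path_weight_sum (snake_grid w n) (-1, 0) (int n + 1, int n + 2) * [:1, 1:]
    \<and> chain_poly filter_le (snake_filters (mirror_word w) n)
        = path_weight_sum (snake_grid w n) (-1, 0) (int n + 1, int n + 2) * [:1, 1:]"
proof -
  interpret snake n w using assms(1) by unfold_locales
  have "[:1, 1::int:] \<noteq> 0" by simp
  then show ?thesis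
    unfolding chain_poly_mirror[OF assms(1)] chain_poly_filters_from_top chain_poly_filters
    by (auto simp only: mult_cancel_right)
qed

end
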